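(* Let $(W,S)$ be a Coxeter system with $S$ finite and suppose that $W=W_{S_1}\times W_{S_2}$ is the (internal) direct product of the parabolic subgroups $W_{S_1}$ and $W_{S_2}$, where $S_1,S_2\subset S$. Suppose that $W$ acts geometrically on a CAT(0) space $X$. Then there exists a closed, convex, $W$-invariant, quasi-dense subspace $X'\subset X$ such that $X'$ splits as a product $X_1\times X_2$ and the action of $W=W_{S_1}\times W_{S_2}$ on $X'=X_1\times X_2$ is the product action.
   Context: A Coxeter group is a group $W$ having a presentation $\langle S \mid (st)^{m(s,t)}=1 \text{ for } s,t\in S\rangle$, where $S$ is a finite set and $m:S\times S\to \mathbb{N}\cup\{\infty\}$ satisfies: (1) $m(s,t)=m(t,s)$ for all $s,t\in S$; (2) $m(s,s)=1$ for all $s\in S$; (3) $m(s,t)\ge 2$ for all $s\ne t$ in $S$ (no relation is imposed when $m(s,t)=\infty$). The pair $(W,S)$ is called a Coxeter system. For $T\subset S$, the parabolic subgroup $W_T$ is the subgroup of $W$ generated by $T$. A group acts geometrically on a (nonempty) metric space $X$ if it acts by isometries, properly discontinuously (each $x\in X$ has a ball $B(x,r)$, $r>0$, such that only finitely many group elements $g$ satisfy $gB(x,r)\cap B(x,r)\neq\emptyset$) and cocompactly. A subspace $X'\subset X$ is quasi-dense if there is a constant $N\ge 0$ such that every point of $X$ lies within distance $N$ of some point of $X'$. That $X'$ splits as a product $X_1\times X_2$ means that $X'$ is isometric to the product of metric spaces $X_1$ and $X_2$ with the $\ell^2$ product metric $d((x_1,x_2),(y_1,y_2))^2=d(x_1,y_1)^2+d(x_2,y_2)^2$.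 The action is the product action if there are isometric actions of $W_{S_1}$ on $X_1$ and of $W_{S_2}$ on $X_2$ such that $(w_1w_2)\cdot(x_1,x_2)=(w_1x_1,w_2x_2)$ for all $w_i\in W_{S_i}$ and $x_i\in X_i$. *)

theory Defs
  imports
    "HOL-Analysis.Analysis"
    "HOL-Library.Extended_Nat"
    "HOL-Algebra.Generated_Groups"
    "HOL-Algebra.Group_Action"
begin

section \<open>Group presentations and Coxeter systems\<close>

text \<open>A word over the alphabet \<open>S\<close> is a list of letters \<open>(s, b)\<close> with \<open>s \<in> S\<close>, where \<open>(s, True)\<close>
  stands for \<open>s\<close> and \<open>(s, False)\<close> for its formal inverse. Two words are related by
  \<open>word_eq S R\<close> iff they represent the same element of the abstract group with generators \<open>S\<close> and
  relators \<open>R\<close>, i.e. of the free group on \<open>S\<close> modulo the normal closure of \<open>R\<close>.\<close>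

type_synonym 'a word = "('a \<times> bool) list"

definition words :: "'a set \<Rightarrow> 'a word set" where
  "words S = lists (S \<times> UNIV)"

inductive word_eq :: "'a set \<Rightarrow> 'a word set \<Rightarrow> 'a word \<Rightarrow> 'a word \<Rightarrow> bool"
  for S :: "'a set" and R :: "'a word set" where
  refl: "u \<in> words S \<Longrightarrow> word_eq S R u u"
| sym: "word_eq S R u v \<Longrightarrow> word_eq S R v u"
| trans: "word_eq S R u v \<Longrightarrow> word_eq S R v w \<Longrightarrow> word_eq S R u w"
| cancel: "u \<in> words S \<Longrightarrow> v \<in> words S \<Longrightarrow> s \<in> S \<Longrightarrow>
    word_eq S R (u @ [(s, b), (s, \<not> b)] @ v) (u @ v)"
| relator: "u \<in> words S \<Longrightarrow> v \<in> words S \<Longrightarrow> r \<in> R \<Longrightarrow> word_eq S R (u @ r @ v) (u @ v)"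

fun word_eval :: "('a, 'b) monoid_scheme \<Rightarrow> 'a word \<Rightarrow> 'a" where
  "word_eval G [] = \<one>\<^bsub>G\<^esub>"
| "word_eval G ((s, b) # w) = (if b then s else inv\<^bsub>G\<^esub> s) \<otimes>\<^bsub>G\<^esub> word_eval G w"

text \<open>\<open>G\<close> has the presentation with generators \<open>S\<close> (elements of \<open>G\<close>) and relators \<open>R\<close>: the
  canonical map from the free group on \<open>S\<close> to \<open>G\<close> is onto and its kernel is the normal closure
  of \<open>R\<close>.\<close>

definition has_presentation :: "('a, 'b) monoid_scheme \<Rightarrow> 'a set \<Rightarrow> 'a word set \<Rightarrow> bool" where
  "has_presentation G S R \<longleftrightarrow>
     group G \<and> S \<subseteq> carrier G \<and> R \<subseteq> words S \<and> generate G S = carrier G \<and>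
     (\<forall>w \<in> words S. word_eval G w = \<one>\<^bsub>G\<^esub> \<longleftrightarrow> word_eq S R w [])"

definition coxeter_matrix :: "'a set \<Rightarrow> ('a \<Rightarrow> 'a \<Rightarrow> enat) \<Rightarrow> bool" where
  "coxeter_matrix S m \<longleftrightarrow>
     (\<forall>s \<in> S. \<forall>t \<in> S. m s t = m t s) \<and>
     (\<forall>s \<in> S. m s s = 1) \<and>
     (\<forall>s \<in> S. \<forall>t \<in> S. s \<noteq> t \<longrightarrow> m s t \<ge> 2)"

definition coxeter_relators :: "'a set \<Rightarrow> ('a \<Rightarrow> 'a \<Rightarrow> enat) \<Rightarrow> 'a word set" where
  "coxeter_relators S m =
     {concat (replicate k [(s, True), (t, True)]) | s t k. s \<in> S \<and> t \<in> S \<and> m s t = enat k}"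

definition coxeter_system :: "('a, 'b) monoid_scheme \<Rightarrow> 'a set \<Rightarrow> bool" where
  "coxeter_system W S \<longleftrightarrow>
     finite S \<and> (\<exists>m. coxeter_matrix S m \<and> has_presentation W S (coxeter_relators S m))"

definition parabolic :: "('a, 'b) monoid_scheme \<Rightarrow> 'a set \<Rightarrow> 'a set" where
  "parabolic W T = generate W T"

definition internal_direct_product :: "('a, 'b) monoid_scheme \<Rightarrow> 'a set \<Rightarrow> 'a set \<Rightarrow> bool" where
  "internal_direct_product G H K \<longleftrightarrow>
     H \<lhd> G \<and> K \<lhd> G \<and> H \<inter> K = {\<one>\<^bsub>G\<^esub>} \<and> H <#>\<^bsub>G\<^esub> K = carrier G"


section \<open>CAT(0) spaces\<close>

definition geodesic_segment :: "'x metric \<Rightarrow> 'x \<Rightarrow> 'x \<Rightarrow> 'x set \<Rightarrow> bool" where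
  "geodesic_segment X p q \<sigma> \<longleftrightarrow>
     (\<exists>(c :: real \<Rightarrow> 'x) l. 0 \<le> l \<and> c 0 = p \<and> c l = q \<and> \<sigma> = c ` {0..l} \<and> \<sigma> \<subseteq> mspace X \<and>
        (\<forall>s \<in> {0..l}. \<forall>t \<in> {0..l}. mdist X (c s) (c t) = \<bar>s - t\<bar>))"

definition geodesic_space :: "'x metric \<Rightarrow> bool" where
  "geodesic_space X \<longleftrightarrow>
     (\<forall>p \<in> mspace X. \<forall>q \<in> mspace X. \<exists>\<sigma>. geodesic_segment X p q \<sigma>)"

text \<open>\<open>x'\<close> is the comparison point, on the Euclidean segment from \<open>p'\<close> to \<open>q'\<close>, of the point \<open>x\<close> on
  the geodesic segment \<open>\<sigma>\<close> from \<open>p\<close> to \<open>q\<close>.\<close>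

definition comparison_point ::
  "'x metric \<Rightarrow> 'x \<Rightarrow> 'x set \<Rightarrow> real^2 \<Rightarrow> real^2 \<Rightarrow> 'x \<Rightarrow> real^2 \<Rightarrow> bool" where
  "comparison_point X p \<sigma> p' q' x x' \<longleftrightarrow>
     x \<in> \<sigma> \<and> x' \<in> closed_segment p' q' \<and> dist p' x' = mdist X p x"

definition CAT0 :: "'x metric \<Rightarrow> bool" where
  "CAT0 X \<longleftrightarrow> geodesic_space X \<and>
     (\<forall>p q r \<sigma> \<tau> \<rho> p' q' r'.
        geodesic_segment X p q \<sigma> \<and> geodesic_segment X q r \<tau> \<and> geodesic_segment X r p \<rho> \<and>
        dist p' q' = mdist X p q \<and> dist q' r' = mdist X q r \<and> dist r' p' = mdist X r p \<longrightarrow>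
        (let comparison = (\<lambda>x x'. comparison_point X p \<sigma> p' q' x x' \<or>
                                  comparison_point X q \<tau> q' r' x x' \<or>
                                  comparison_point X r \<rho> r' p' x x')
         in \<forall>x x' y y'. comparison x x' \<and> comparison y y' \<longrightarrow> mdist X x y \<le> dist x' y'))"

text \<open>Geodesics are required to stay in \<open>C\<close>; their existence is part of \<^const>\<open>geodesic_space\<close>.\<close>

definition geodesically_convex :: "'x metric \<Rightarrow> 'x set \<Rightarrow> bool" where
  "geodesically_convex X C \<longleftrightarrow> C \<subseteq> mspace X \<and>
     (\<forall>p \<in> C. \<forall>q \<in> C. \<forall>\<sigma>. geodesic_segment X p q \<sigma> \<longrightarrow> \<sigma> \<subseteq> C)"

definition quasi_dense :: "'x metric \<Rightarrow> 'x set \<Rightarrow> bool" where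
  "quasi_dense X Y \<longleftrightarrow> Y \<subseteq> mspace X \<and>
     (\<exists>N \<ge> 0. \<forall>x \<in> mspace X. \<exists>y \<in> Y. mdist X x y \<le> N)"

definition isometry_between :: "'x metric \<Rightarrow> 'y metric \<Rightarrow> ('x \<Rightarrow> 'y) \<Rightarrow> bool" where
  "isometry_between X Y f \<longleftrightarrow> bij_betw f (mspace X) (mspace Y) \<and>
     (\<forall>x \<in> mspace X. \<forall>y \<in> mspace X. mdist Y (f x) (f y) = mdist X x y)"


section \<open>Isometric and geometric actions\<close>

definition isometric_action ::
  "('a, 'b) monoid_scheme \<Rightarrow> 'x metric \<Rightarrow> ('a \<Rightarrow> 'x \<Rightarrow> 'x) \<Rightarrow> bool" where
  "isometric_action G X \<phi> \<longleftrightarrow> group_action G (mspace X) \<phi> \<and>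
     (\<forall>g \<in> carrier G. isometry_between X X (\<phi> g))"

definition properly_discontinuous ::
  "('a, 'b) monoid_scheme \<Rightarrow> 'x metric \<Rightarrow> ('a \<Rightarrow> 'x \<Rightarrow> 'x) \<Rightarrow> bool" where
  "properly_discontinuous G X \<phi> \<longleftrightarrow>
     (\<forall>x \<in> mspace X. \<exists>r > 0.
        finite {g \<in> carrier G. \<phi> g ` mball_of X x r \<inter> mball_of X x r \<noteq> {}})"

definition cocompact ::
  "('a, 'b) monoid_scheme \<Rightarrow> 'x metric \<Rightarrow> ('a \<Rightarrow> 'x \<Rightarrow> 'x) \<Rightarrow> bool" where
  "cocompact G X \<phi> \<longleftrightarrow>
     (\<exists>K. compactin (mtopology_of X) K \<and> (\<Union>g \<in> carrier G. \<phi> g ` K) = mspace X)"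

definition geometric_action ::
  "('a, 'b) monoid_scheme \<Rightarrow> 'x metric \<Rightarrow> ('a \<Rightarrow> 'x \<Rightarrow> 'x) \<Rightarrow> bool" where
  "geometric_action G X \<phi> \<longleftrightarrow> mspace X \<noteq> {} \<and>
     isometric_action G X \<phi> \<and> properly_discontinuous G X \<phi> \<and> cocompact G X \<phi>"

text \<open>Under the identification \<open>f\<close> of \<open>Y\<close> with the \<open>\<ell>\<^sup>2\<close> product of \<open>X\<^sub>1\<close> and \<open>X\<^sub>2\<close>
  (the metric of \<^const>\<open>prod_metric\<close> is the \<open>\<ell>\<^sup>2\<close> one), the action \<open>\<phi>\<close> of \<open>G = H \<times> K\<close> on the
  subset \<open>Y\<close> of \<open>X\<close> is the product of isometric actions of \<open>H\<close> on \<open>X\<^sub>1\<close> and of \<open>K\<close> on \<open>X\<^sub>2\<close>.\<close>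

definition product_action_via ::
  "('a, 'b) monoid_scheme \<Rightarrow> 'a set \<Rightarrow> 'a set \<Rightarrow> ('a \<Rightarrow> 'x \<Rightarrow> 'x) \<Rightarrow> 'x set \<Rightarrow>
   'y metric \<Rightarrow> 'z metric \<Rightarrow> ('x \<Rightarrow> 'y \<times> 'z) \<Rightarrow> bool" where
  "product_action_via G H K \<phi> Y X\<^sub>1 X\<^sub>2 f \<longleftrightarrow>
     (\<exists>\<phi>\<^sub>1 \<phi>\<^sub>2. isometric_action (G\<lparr>carrier := H\<rparr>) X\<^sub>1 \<phi>\<^sub>1 \<and>
              isometric_action (G\<lparr>carrier := K\<rparr>) X\<^sub>2 \<phi>\<^sub>2 \<and>
              (\<forall>h \<in> H. \<forall>k \<in> K. \<forall>y \<in> Y.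
                 f (\<phi> (h \<otimes>\<^bsub>G\<^esub> k) y) = (\<phi>\<^sub>1 h (fst (f y)), \<phi>\<^sub>2 k (snd (f y)))))"

end

theory Submission
  imports Defs
begin

text \<open>Only two features of Coxeter groups matter: \<open>W\<close> and \<open>W\<^bsub>S\<^sub>2\<^esub>\<close> are generated by finitely many
  involutions. On a minimal closed convex invariant set, the displacement of an isometry commuting
  with the group is a convex invariant function, hence constant; an involution fixes a midpoint, so
  a commuting involution acts trivially. If \<open>z\<close> is central in \<open>W\<close>, the asymptotic direction of
  \<open>z\<close> gives a homomorphism \<open>W \<rightarrow> \<real>\<close>, which vanishes because \<open>W\<close> is generated by involutions; hence
  \<open>z\<close> acts trivially on a minimal closed convex \<open>W\<close>-invariant set \<open>Y\<close>. Therefore \<open>W\<^bsub>S\<^sub>1\<^esub>\<close> acts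
  cocompactly on the part of \<open>Y\<close> that the generators in \<open>S\<^sub>2\<close> move by at most a constant, and
  there is a minimal closed convex \<open>W\<^bsub>S\<^sub>1\<^esub>\<close>-invariant set \<open>C\<close>. The union \<open>X'\<close> of all such sets is
  closed and convex; any two of them are parallel, and the nearest-point projections between them
  are compatible, so \<open>X'\<close> is the product of \<open>C\<close> and a fibre of the projection to \<open>C\<close>. Finally \<open>W\<^bsub>S\<^sub>2\<^esub>\<close> acts trivially on
  the factor \<open>C\<close>, being generated by involutions commuting with \<open>W\<^bsub>S\<^sub>1\<^esub>\<close>.\<close>

section \<open>Complete CAT(0) spaces\<close>

text \<open>Involutions have to enter: two linearly independent, non-orthogonal translations give a
  geometric action of Z x Z on the plane that is not a product action. The obstruction is a central
  element that translates. It appears when a minimal set for the first factor is sought: this factor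
  need not act cocompactly on \<open>X\<close>, and bounding the displacements by the generators of
  the second factor determines the second component of a group element only up to the centre.
  Boundary at infinity, Busemann functions and the flat strip theorem are replaced by the
  quadrilateral inequality, read as boundedness of a quasi-inner product. The triviality proofs for
  central elements and for the holonomy around three minimal sets share one shape: a map commuting
  with the group has constant displacement \<delta> on a minimal set, so its power of exponent 2^k
  moves points by at least 2^k \<delta>, while telescoping bounded quasi-inner products shows that
  the squared displacement of the n-th power grows at most linearly in n. Completeness of
  \<open>X\<close> is extracted from the geometric action.\<close>

text \<open>The inequality is the CN inequality of Bruhat and Tits, stated for all points of a geodesic
  instead of its midpoint only.\<close>

locale hadamard_space = Metric_space M d for M :: "'x set" and d +
  assumes complete: mcomplete
    and ex_geodesic_point: "\<lbrakk>p \<in> M; q \<in> M; 0 \<le> t; t \<le> 1\<rbrakk> \<Longrightarrow>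
      \<exists>m\<in>M. d p m = t * d p q \<and> d m q = (1 - t) * d p q \<and>
        (\<forall>r\<in>M. (d r m)\<^sup>2 \<le> (1 - t) * (d r p)\<^sup>2 + t * (d r q)\<^sup>2 - t * (1 - t) * (d p q)\<^sup>2)"
begin

text \<open>The point at fraction \<open>t\<close> of the geodesic from \<open>p\<close> to
  \<open>q\<close>; by \<open>gp_unique\<close> the choice operator has nothing to choose.\<close>

definition gp :: "'x \<Rightarrow> 'x \<Rightarrow> real \<Rightarrow> 'x" where
  "gp p q t = (SOME m. m \<in> M \<and> d p m = t * d p q \<and> d m q = (1 - t) * d p q \<and>
     (\<forall>r\<in>M. (d r m)\<^sup>2 \<le> (1 - t) * (d r p)\<^sup>2 + t * (d r q)\<^sup>2 - t * (1 - t) * (d p q)\<^sup>2))"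

lemma gp_props:
  assumes "p \<in> M" "q \<in> M" "0 \<le> t" "t \<le> 1"
  shows gp_in: "gp p q t \<in> M"
    and dist_gp_left: "d p (gp p q t) = t * d p q"
    and dist_gp_right: "d (gp p q t) q = (1 - t) * d p q"
    and gp_CN: "\<And>r. r \<in> M \<Longrightarrow>
      (d r (gp p q t))\<^sup>2 \<le> (1 - t) * (d r p)\<^sup>2 + t * (d r q)\<^sup>2 - t * (1 - t) * (d p q)\<^sup>2"
proof -
  have "\<exists>m. m \<in> M \<and> d p m = t * d p q \<and> d m q = (1 - t) * d p q \<and>
     (\<forall>r\<in>M. (d r m)\<^sup>2 \<le> (1 - t) * (d r p)\<^sup>2 + t * (d r q)\<^sup>2 - t * (1 - t) * (d p q)\<^sup>2)"
    using ex_geodesic_point[OF assms] by blast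
  from someI_ex[OF this, folded gp_def]
  show "gp p q t \<in> M" "d p (gp p q t) = t * d p q" "d (gp p q t) q = (1 - t) * d p q"
    "\<And>r. r \<in> M \<Longrightarrow>
      (d r (gp p q t))\<^sup>2 \<le> (1 - t) * (d r p)\<^sup>2 + t * (d r q)\<^sup>2 - t * (1 - t) * (d p q)\<^sup>2"
    by auto
qed

text \<open>With \<open>m\<close> itself as third point, the right-hand side of the CN inequality
  collapses to zero.\<close>

lemma gp_unique:
  assumes "p \<in> M" "q \<in> M" "0 \<le> t" "t \<le> 1"
    and "m \<in> M" "d p m = t * d p q" "d m q = (1 - t) * d p q"
  shows "m = gp p q t"
proof -
  have "(d m (gp p q t))\<^sup>2 \<le> (1 - t) * (t * d p q)\<^sup>2 + t * ((1 - t) * d p q)\<^sup>2 - t * (1 - t) * (d p q)\<^sup>2"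
    using gp_CN[of p q t m] assms by (simp add: commute)
  also have "\<dots> = 0"
    by (simp add: power2_eq_square algebra_simps)
  finally have "d m (gp p q t) = 0"
    by simp
  then show ?thesis
    using gp_in[of p q t] assms by simp
qed

lemma gp_commute:
  assumes "p \<in> M" "q \<in> M" "0 \<le> t" "t \<le> 1"
  shows "gp p q t = gp q p (1 - t)"
  using assms gp_in dist_gp_left dist_gp_right by (intro gp_unique) (auto simp: commute)

text \<open>Distances to the endpoints determine the point. The local form with \<open>C\<close>
  serves maps that are isometric only on a minimal set, such as compositions of projections.\<close>

lemma gp_image:
  assumes "p \<in> C" "q \<in> C" "gp p q t \<in> C" "0 \<le> t" "t \<le> 1" "C \<subseteq> M"
    and e: "\<And>x. x \<in> C \<Longrightarrow> e x \<in> M" "\<And>x y. \<lbrakk>x \<in> C; y \<in> C\<rbrakk> \<Longrightarrow> d (e x) (e y) = d x y"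
  shows "e (gp p q t) = gp (e p) (e q) t"
  using assms by (intro gp_unique) (auto simp: dist_gp_left dist_gp_right subset_iff)

text \<open>CN is used twice, for the sides \<open>p r\<close> and \<open>p q\<close>; inserting the
  second estimate into the first leaves exactly the square of the Euclidean value.\<close>

lemma dist_gp_same_left:
  assumes M: "p \<in> M" "q \<in> M" "r \<in> M" and t: "0 \<le> t" "t \<le> 1"
  shows "d (gp p q t) (gp p r t) \<le> t * d q r"
proof -
  let ?x = "gp p q t"
  have x: "?x \<in> M"
    using assms gp_in by blast
  have 1: "(d ?x (gp p r t))\<^sup>2 \<le> (1 - t) * (d ?x p)\<^sup>2 + t * (d ?x r)\<^sup>2 - t * (1 - t) * (d p r)\<^sup>2"
    using gp_CN x assms by blast
  have 2: "(d r ?x)\<^sup>2 \<le> (1 - t) * (d r p)\<^sup>2 + t * (d r q)\<^sup>2 - t * (1 - t) * (d p q)\<^sup>2"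
    using gp_CN assms by blast
  have "d ?x p = t * d p q"
    using dist_gp_left assms by (simp add: commute)
  then have "(d ?x (gp p r t))\<^sup>2 \<le> (1 - t) * (t * d p q)\<^sup>2
      + t * ((1 - t) * (d r p)\<^sup>2 + t * (d r q)\<^sup>2 - t * (1 - t) * (d p q)\<^sup>2) - t * (1 - t) * (d p r)\<^sup>2"
    using 1 mult_left_mono[OF 2 t(1)] by (simp add: commute)
  also have "\<dots> = (t * d q r)\<^sup>2"
    by (simp add: power2_eq_square commute[of r] algebra_simps)
  finally show ?thesis
    using t by (simp add: power2_le_iff_abs_le)
qed

text \<open>Convexity of the metric: the diagonal from \<open>p\<close> to \<open>q'\<close> cuts
  the quadrilateral into two triangles, each covered by \<open>dist_gp_same_left\<close>.\<close>

lemma dist_gp_gp: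
  assumes M: "p \<in> M" "q \<in> M" "p' \<in> M" "q' \<in> M" and t: "0 \<le> t" "t \<le> 1"
  shows "d (gp p q t) (gp p' q' t) \<le> (1 - t) * d p p' + t * d q q'"
proof -
  have "d (gp p q t) (gp p q' t) \<le> t * d q q'"
    using assms by (intro dist_gp_same_left)
  moreover have "d (gp p q' t) (gp p' q' t) \<le> (1 - t) * d p p'"
    using assms dist_gp_same_left[of q' p p' "1 - t"] by (simp add: gp_commute[of _ q'])
  moreover have "d (gp p q t) (gp p' q' t) \<le> d (gp p q t) (gp p q' t) + d (gp p q' t) (gp p' q' t)"
    using assms gp_in by (intro triangle)
  ultimately show ?thesis
    by simp
qed

text \<open>The midpoint of one diagonal is compared by CN with both ends of the other. Flat
  parallelograms give equality, which is the source of the later rigidity.\<close>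

lemma quadrilateral:
  assumes "a \<in> M" "b \<in> M" "c \<in> M" "e \<in> M"
  shows "(d a c)\<^sup>2 + (d b e)\<^sup>2 \<le> (d a b)\<^sup>2 + (d b c)\<^sup>2 + (d c e)\<^sup>2 + (d a e)\<^sup>2"
proof -
  define m where "m = gp b e (1/2)"
  have m: "m \<in> M"
    using gp_in assms by (simp add: m_def)
  have 1: "(d a m)\<^sup>2 \<le> (d a b)\<^sup>2 / 2 + (d a e)\<^sup>2 / 2 - (d b e)\<^sup>2 / 4"
    using gp_CN[of b e "1/2" a] assms by (simp add: m_def)
  have 2: "(d c m)\<^sup>2 \<le> (d c b)\<^sup>2 / 2 + (d c e)\<^sup>2 / 2 - (d b e)\<^sup>2 / 4"
    using gp_CN[of b e "1/2" c] assms by (simp add: m_def)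
  have "d a c \<le> d a m + d c m"
    using triangle[of a m c] assms m by (simp add: commute)
  then have "(d a c)\<^sup>2 \<le> (d a m + d c m)\<^sup>2"
    by (simp add: power_mono)
  also have "\<dots> \<le> 2 * (d a m)\<^sup>2 + 2 * (d c m)\<^sup>2"
    using sum_squares_bound[of "d a m" "d c m"] by (simp add: power2_sum)
  finally show ?thesis
    using 1 2 by (simp add: commute)
qed

text \<open>Twice the quasi-inner product of \<open>\<rightarrow>ab\<close> and \<open>\<rightarrow>ce\<close>, in the sense of Berg and
  Nikolaev.\<close>

definition quasi_inner :: "'x \<Rightarrow> 'x \<Rightarrow> 'x \<Rightarrow> 'x \<Rightarrow> real" where
  "quasi_inner a b c e = (d a e)\<^sup>2 + (d b c)\<^sup>2 - (d a c)\<^sup>2 - (d b e)\<^sup>2"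

lemma quasi_inner_add_left: "quasi_inner a b c e + quasi_inner b b' c e = quasi_inner a b' c e"
  by (simp add: quasi_inner_def)

text \<open>A weak Cauchy-Schwarz inequality: the cyclic orders \<open>a b c e\<close> and
  \<open>a b e c\<close> of the quadrilateral inequality bound the two signs.\<close>

lemma quasi_inner_bound:
  assumes "a \<in> M" "b \<in> M" "c \<in> M" "e \<in> M"
  shows "\<bar>quasi_inner a b c e\<bar> \<le> (d a b)\<^sup>2 + (d c e)\<^sup>2"
  using quadrilateral[of a b c e] quadrilateral[of a b e c] assms
  by (simp add: quasi_inner_def commute abs_le_iff)

subsection \<open>Closed convex sets\<close>

definition gconvex :: "'x set \<Rightarrow> bool" where
  "gconvex C \<longleftrightarrow> C \<subseteq> M \<and> (\<forall>p\<in>C. \<forall>q\<in>C. \<forall>t\<in>{0..1}. gp p q t \<in> C)"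

definition closed_convex :: "'x set \<Rightarrow> bool" where
  "closed_convex C \<longleftrightarrow> closedin mtopology C \<and> gconvex C"

lemma closed_convexI:
  assumes "C \<subseteq> M"
    and "\<And>\<sigma> l. \<lbrakk>\<And>n. \<sigma> n \<in> C; limitin mtopology \<sigma> l sequentially\<rbrakk> \<Longrightarrow> l \<in> C"
    and "\<And>p q t. \<lbrakk>p \<in> C; q \<in> C; 0 \<le> t; t \<le> 1\<rbrakk> \<Longrightarrow> gp p q t \<in> C"
  shows "closed_convex C"
  unfolding closed_convex_def gconvex_def metric_closedin_iff_sequentially_closed
proof (intro conjI ballI allI impI)
  fix \<sigma> l assume *: "range \<sigma> \<subseteq> C \<and> limitin mtopology \<sigma> l sequentially"
  then have "\<And>n. \<sigma> n \<in> C"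
    by blast
  then show "l \<in> C"
    using assms(2) * by blast
next
  fix p q t assume "p \<in> C" "q \<in> C" "t \<in> {0..1::real}"
  then show "gp p q t \<in> C"
    using assms(3) by simp
qed (rule assms(1))+

lemma closed_convexD:
  assumes "closed_convex C"
  shows "C \<subseteq> M"
    and "\<And>\<sigma> l. \<lbrakk>\<And>n. \<sigma> n \<in> C; limitin mtopology \<sigma> l sequentially\<rbrakk> \<Longrightarrow> l \<in> C"
    and "\<And>p q t. \<lbrakk>p \<in> C; q \<in> C; 0 \<le> t; t \<le> 1\<rbrakk> \<Longrightarrow> gp p q t \<in> C"
proof -
  have 1: "C \<subseteq> M" "\<forall>\<sigma> l. range \<sigma> \<subseteq> C \<and> limitin mtopology \<sigma> l sequentially \<longrightarrow> l \<in> C"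
    and 2: "\<forall>p\<in>C. \<forall>q\<in>C. \<forall>t\<in>{0..1}. gp p q t \<in> C"
    using assms
    unfolding closed_convex_def gconvex_def metric_closedin_iff_sequentially_closed by blast+
  show "C \<subseteq> M"
    by (rule 1)
  show "l \<in> C" if "\<And>n. \<sigma> n \<in> C" "limitin mtopology \<sigma> l sequentially" for \<sigma> l
    using 1(2) that by (meson image_subsetI)
  show "gp p q t \<in> C" if "p \<in> C" "q \<in> C" "0 \<le> t" "t \<le> 1" for p q t
    using 2 that by simp
qed

lemma closed_convex_Inter:
  assumes "\<C> \<noteq> {}" "\<And>C. C \<in> \<C> \<Longrightarrow> closed_convex C"
  shows "closed_convex (\<Inter>\<C>)"
proof -
  have "closedin mtopology (\<Inter>\<C>)"
    using assms by (intro closedin_Inter) (auto simp: closed_convex_def)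
  moreover have "gconvex (\<Inter>\<C>)"
    using assms unfolding gconvex_def closed_convex_def by blast
  ultimately show ?thesis
    by (simp add: closed_convex_def)
qed

lemma tendsto_dist:
  assumes "limitin mtopology \<sigma> l sequentially" "limitin mtopology \<tau> k sequentially"
    and "\<And>n. \<sigma> n \<in> M" "\<And>n. \<tau> n \<in> M"
  shows "(\<lambda>n. d (\<sigma> n) (\<tau> n)) \<longlonglongrightarrow> d l k"
proof -
  have l: "l \<in> M" "(\<lambda>n. d (\<sigma> n) l) \<longlonglongrightarrow> 0" and k: "k \<in> M" "(\<lambda>n. d (\<tau> n) k) \<longlonglongrightarrow> 0"
    using assms by (auto simp: limitin_metric_dist_null)
  have *: "norm (d (\<sigma> n) (\<tau> n) - d l k) \<le> d (\<sigma> n) l + d (\<tau> n) k" for n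
    using triangle[OF assms(3) l(1) assms(4), of n n] triangle'[OF l(1) k(1) assms(4)[of n]]
      triangle''[OF l(1) assms(3) k(1), of n] triangle[OF assms(3) assms(4) k(1), of n n]
    unfolding real_norm_def abs_le_iff by linarith
  have "(\<lambda>n. d (\<sigma> n) l + d (\<tau> n) k) \<longlonglongrightarrow> 0"
    using tendsto_add[OF l(2) k(2)] by simp
  then have "(\<lambda>n. d (\<sigma> n) (\<tau> n) - d l k) \<longlonglongrightarrow> 0"
    by (rule Lim_null_comparison[OF always_eventually[OF allI[OF *]]])
  then show ?thesis
    by (simp add: LIM_zero_iff)
qed

section \<open>Nearest-point projection onto closed convex sets\<close>

lemma ex_nearest_point:
  assumes C: "closed_convex C" "C \<noteq> {}" and x: "x \<in> M"
  shows "\<exists>y\<in>C. \<forall>c\<in>C. d x y \<le> d x c"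
proof -
  note CM = closed_convexD[OF C(1)]
  define D where "D = (INF c\<in>C. (d x c)\<^sup>2)"
  have bdd: "bdd_below ((\<lambda>c. (d x c)\<^sup>2) ` C)"
    by (rule bdd_belowI[of _ 0]) auto
  have D: "D \<le> (d x c)\<^sup>2" if "c \<in> C" for c
    unfolding D_def using bdd that by (rule cINF_lower)
  have "\<exists>c\<in>C. (d x c)\<^sup>2 < D + inverse (Suc n)" for n
    using cINF_less_iff[OF C(2) bdd, of "D + inverse (Suc n)"] by (simp add: D_def)
  then obtain c where c: "\<And>n. c n \<in> C" "\<And>n. (d x (c n))\<^sup>2 < D + inverse (Suc n)"
    by metis
  \<comment> \<open>The midpoint of \<open>c i\<close> and \<open>c j\<close> lies in
    \<open>C\<close>, so its squared distance to \<open>x\<close> is at least \<open>D\<close>; CN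
    turns the near-minimality of both ends into their closeness.\<close>
  have near: "(d (c i) (c j))\<^sup>2 \<le> 2 * inverse (Suc i) + 2 * inverse (Suc j)" for i j
  proof -
    have M: "c i \<in> M" "c j \<in> M"
      using c(1) CM(1) by auto
    have "gp (c i) (c j) (1/2) \<in> C"
      using CM(3) c(1) by simp
    then show ?thesis
      using gp_CN[OF M, of "1/2" x] D[of "gp (c i) (c j) (1/2)"] x c(2)[of i] c(2)[of j] by simp
  qed
  have "MCauchy c"
    unfolding MCauchy_def
  proof (intro conjI allI impI)
    show "range c \<subseteq> M"
      using c(1) CM(1) by auto
    fix \<epsilon> :: real assume \<epsilon>: "\<epsilon> > 0"
    then obtain N where N: "inverse (real (Suc N)) < \<epsilon>\<^sup>2 / 4"
      using reals_Archimedean[of "\<epsilon>\<^sup>2 / 4"] by auto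
    show "\<exists>N. \<forall>n n'. N \<le> n \<longrightarrow> N \<le> n' \<longrightarrow> d (c n) (c n') < \<epsilon>"
    proof (intro exI allI impI)
      fix i j assume "N \<le> i" "N \<le> j"
      then have "inverse (real (Suc i)) \<le> inverse (real (Suc N))" "inverse (real (Suc j)) \<le> inverse (real (Suc N))"
        by (auto intro!: le_imp_inverse_le)
      then have "(d (c i) (c j))\<^sup>2 < \<epsilon>\<^sup>2"
        using near[of i j] N by linarith
      then show "d (c i) (c j) < \<epsilon>"
        using \<epsilon> by (simp add: power2_less_imp_less)
    qed
  qed
  then obtain y where y: "limitin mtopology c y sequentially"
    using complete by (auto simp: mcomplete_def)
  have yC: "y \<in> C"
    using CM(2) c(1) y by blast
  have "(\<lambda>n. d x (c n)) \<longlonglongrightarrow> d x y"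
    using x y c(1) CM(1) by (intro tendsto_dist) (simp_all add: subset_iff)
  then have "(\<lambda>n. (d x (c n))\<^sup>2) \<longlonglongrightarrow> (d x y)\<^sup>2"
    by (intro tendsto_intros)
  moreover have "(\<lambda>n. D + inverse (real (Suc n))) \<longlonglongrightarrow> D + 0"
    by (intro tendsto_add tendsto_const LIMSEQ_inverse_real_of_nat)
  ultimately have "(d x y)\<^sup>2 \<le> D + 0"
    by (rule LIMSEQ_le) (use c(2) less_imp_le in blast)
  then have "d x y \<le> d x z" if "z \<in> C" for z
    using D[OF that] power2_le_imp_le[of "d x y" "d x z"] by fastforce
  then show ?thesis
    using yC by blast
qed

definition proj :: "'x set \<Rightarrow> 'x \<Rightarrow> 'x" where
  "proj C x = (SOME y. y \<in> C \<and> (\<forall>c\<in>C. d x y \<le> d x c))"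

lemma proj_props:
  assumes "closed_convex C" "C \<noteq> {}" "x \<in> M"
  shows proj_in: "proj C x \<in> C" and proj_le: "\<And>c. c \<in> C \<Longrightarrow> d x (proj C x) \<le> d x c"
proof -
  have "\<exists>y. y \<in> C \<and> (\<forall>c\<in>C. d x y \<le> d x c)"
    using ex_nearest_point[OF assms] by blast
  from someI_ex[OF this, folded proj_def]
  show "proj C x \<in> C" "\<And>c. c \<in> C \<Longrightarrow> d x (proj C x) \<le> d x c"
    by auto
qed

lemma proj_in_space:
  assumes "closed_convex C" "C \<noteq> {}" "x \<in> M"
  shows "proj C x \<in> M"
  using proj_in[OF assms] closed_convexD(1)[OF assms(1)] by auto

text \<open>Push the foot a fraction \<open>t\<close> towards \<open>y\<close>: the distance to
  \<open>x\<close> cannot drop, and CN bounds it from above. Dividing by \<open>t\<close> and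
  letting it tend to 0 yields the metric form of an obtuse angle at the foot.\<close>

lemma proj_obtuse:
  assumes C: "closed_convex C" "C \<noteq> {}" and x: "x \<in> M" and y: "y \<in> C"
  shows "(d x (proj C x))\<^sup>2 + (d (proj C x) y)\<^sup>2 \<le> (d x y)\<^sup>2"
proof -
  let ?p = "proj C x"
  have p: "?p \<in> C" "?p \<in> M" "y \<in> M"
    using assms proj_in proj_in_space closed_convexD(1)[OF C(1)] by auto
  have *: "(d x ?p)\<^sup>2 + (1 - t) * (d ?p y)\<^sup>2 \<le> (d x y)\<^sup>2" if t: "0 < t" "t < 1" for t
  proof -
    have "gp ?p y t \<in> C"
      using closed_convexD(3)[OF C(1)] p y t by simp
    then have "(d x ?p)\<^sup>2 \<le> (d x (gp ?p y t))\<^sup>2"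
      using proj_le[OF C x] by (simp add: power_mono)
    also have "\<dots> \<le> (1 - t) * (d x ?p)\<^sup>2 + t * (d x y)\<^sup>2 - t * (1 - t) * (d ?p y)\<^sup>2"
      using gp_CN p x t by simp
    finally have "t * ((d x ?p)\<^sup>2 + (1 - t) * (d ?p y)\<^sup>2) \<le> t * (d x y)\<^sup>2"
      by (simp add: algebra_simps)
    then show ?thesis
      using t by simp
  qed
  have "((\<lambda>t. (d x ?p)\<^sup>2 + (1 - t) * (d ?p y)\<^sup>2) \<longlongrightarrow> (d x ?p)\<^sup>2 + (1 - 0) * (d ?p y)\<^sup>2) (at_right 0)"
    by (intro tendsto_intros)
  moreover have "\<forall>\<^sub>F t in at_right 0. (d x ?p)\<^sup>2 + (1 - t) * (d ?p y)\<^sup>2 \<le> (d x y)\<^sup>2"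
    using * by (auto simp: eventually_at_right[of 0 1] intro!: exI[of _ 1])
  ultimately show ?thesis
    by (simp add: tendsto_upperbound)
qed

lemma proj_unique:
  assumes C: "closed_convex C" and x: "x \<in> M" and y: "y \<in> C" "\<And>c. c \<in> C \<Longrightarrow> d x y \<le> d x c"
  shows "proj C x = y"
proof -
  have C': "C \<noteq> {}"
    using y by blast
  have "(d x y)\<^sup>2 \<le> (d x (proj C x))\<^sup>2"
    using y proj_in[OF C C' x] by (simp add: power_mono)
  then have "(d (proj C x) y)\<^sup>2 \<le> 0"
    using proj_obtuse[OF C C' x y(1)] by linarith
  then have "d (proj C x) y = 0"
    by simp
  then show ?thesis
    using proj_in_space[OF C C' x] y(1) closed_convexD(1)[OF C] by auto
qed

text \<open>Adding the obtuse-angle inequalities at both feet to the quadrilateral inequality for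
  \<open>x\<close>, \<open>?p\<close>, \<open>?q\<close>, \<open>y\<close> cancels everything but
  the two sides compared.\<close>

lemma proj_lipschitz:
  assumes C: "closed_convex C" "C \<noteq> {}" and x: "x \<in> M" and y: "y \<in> M"
  shows "d (proj C x) (proj C y) \<le> d x y"
proof -
  let ?p = "proj C x" and ?q = "proj C y"
  have M: "?p \<in> C" "?q \<in> C" "?p \<in> M" "?q \<in> M"
    using assms proj_in proj_in_space by auto
  have "(d x ?p)\<^sup>2 + (d ?p ?q)\<^sup>2 \<le> (d x ?q)\<^sup>2" "(d y ?q)\<^sup>2 + (d ?q ?p)\<^sup>2 \<le> (d y ?p)\<^sup>2"
    using proj_obtuse[OF C] x y M by auto
  moreover have "(d x ?q)\<^sup>2 + (d ?p y)\<^sup>2 \<le> (d x ?p)\<^sup>2 + (d ?p ?q)\<^sup>2 + (d ?q y)\<^sup>2 + (d x y)\<^sup>2"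
    using quadrilateral x y M by blast
  ultimately have "(d ?p ?q)\<^sup>2 \<le> (d x y)\<^sup>2"
    unfolding commute[of ?q ?p] commute[of ?p y] commute[of ?q y] by linarith
  then show ?thesis
    by (rule power2_le_imp_le) simp
qed

lemma proj_image:
  assumes C: "closed_convex C" "C \<noteq> {}" "closed_convex (e ` C)" and x: "x \<in> M"
    and e: "\<And>x. x \<in> M \<Longrightarrow> e x \<in> M" "\<And>x y. \<lbrakk>x \<in> M; y \<in> M\<rbrakk> \<Longrightarrow> d (e x) (e y) = d x y"
  shows "proj (e ` C) (e x) = e (proj C x)"
  using assms proj_in[OF C(1,2) x] proj_le[OF C(1,2) x] closed_convexD(1)[OF C(1)]
  by (intro proj_unique) (auto simp: subset_iff)

lemma proj_self:
  assumes "closed_convex C" "x \<in> C"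
  shows "proj C x = x"
  using assms closed_convexD(1)[OF assms(1)] by (intro proj_unique) auto

text \<open>The geodesic between the two feet stays in \<open>C\<close> and competes with the true
  foot.\<close>

lemma dist_proj_gp:
  assumes C: "closed_convex C" "C \<noteq> {}" and M: "p \<in> M" "q \<in> M" and t: "0 \<le> t" "t \<le> 1"
  shows "d (gp p q t) (proj C (gp p q t)) \<le> (1 - t) * d p (proj C p) + t * d q (proj C q)"
proof -
  have "gp (proj C p) (proj C q) t \<in> C"
    using closed_convexD(3)[OF C(1)] proj_in[OF C] M t by simp
  then have "d (gp p q t) (proj C (gp p q t)) \<le> d (gp p q t) (gp (proj C p) (proj C q) t)"
    using proj_le[OF C gp_in] M t by blast
  also have "\<dots> \<le> (1 - t) * d p (proj C p) + t * d q (proj C q)"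
    using dist_gp_gp M t proj_in_space[OF C] by blast
  finally show ?thesis .
qed

lemma dist_proj_diff:
  assumes C: "closed_convex C" "C \<noteq> {}" and M: "p \<in> M" "q \<in> M"
  shows "d p (proj C p) \<le> d q (proj C q) + d p q"
proof -
  have "d p (proj C p) \<le> d p (proj C q)"
    using proj_le[OF C] proj_in[OF C] M by blast
  also have "\<dots> \<le> d p q + d q (proj C q)"
    using triangle M proj_in_space[OF C] by blast
  finally show ?thesis by simp
qed

end

section \<open>Minimal closed convex invariant sets\<close>

lemma convex_combination_le_max:
  fixes a b t :: real
  assumes "0 \<le> t" "t \<le> 1"
  shows "(1 - t) * a + t * b \<le> max a b"
  using convex_bound_le[of a "max a b" b "1 - t" t] assms by simp

text \<open>A set of maps rather than a group, so that the image of any subgroup under \<phi> is an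
  instance. The inverses ensure that invariant sets are mapped onto themselves.\<close>

locale hadamard_isometries = hadamard_space +
  fixes \<Gamma> :: "('a \<Rightarrow> 'a) set"
  assumes maps: "\<And>\<gamma> x. \<lbrakk>\<gamma> \<in> \<Gamma>; x \<in> M\<rbrakk> \<Longrightarrow> \<gamma> x \<in> M"
    and isometric: "\<And>\<gamma> x y. \<lbrakk>\<gamma> \<in> \<Gamma>; x \<in> M; y \<in> M\<rbrakk> \<Longrightarrow> d (\<gamma> x) (\<gamma> y) = d x y"
    and ex_inverse: "\<And>\<gamma>. \<gamma> \<in> \<Gamma> \<Longrightarrow> \<exists>\<gamma>'\<in>\<Gamma>. \<forall>x\<in>M. \<gamma> (\<gamma>' x) = x"
begin

definition invariant :: "'a set \<Rightarrow> bool" where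
  "invariant C \<longleftrightarrow> (\<forall>\<gamma>\<in>\<Gamma>. \<forall>x\<in>C. \<gamma> x \<in> C)"

definition minimal :: "'a set \<Rightarrow> bool" where
  "minimal C \<longleftrightarrow> closed_convex C \<and> C \<noteq> {} \<and> invariant C \<and>
     (\<forall>D. D \<subseteq> C \<and> D \<noteq> {} \<and> closed_convex D \<and> invariant D \<longrightarrow> D = C)"

lemma minimalD:
  assumes "minimal C"
  shows minimal_closed_convex: "closed_convex C" and minimal_nonempty: "C \<noteq> {}"
    and minimal_invariant: "\<And>\<gamma> x. \<lbrakk>\<gamma> \<in> \<Gamma>; x \<in> C\<rbrakk> \<Longrightarrow> \<gamma> x \<in> C"
    and minimal_subset: "C \<subseteq> M"
    and minimal_minimal: "\<And>D. \<lbrakk>D \<subseteq> C; D \<noteq> {}; closed_convex D; invariant D\<rbrakk> \<Longrightarrow> D = C"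
  using assms closed_convexD(1) unfolding minimal_def invariant_def by blast+

lemma invariant_image:
  assumes "C \<subseteq> M" "invariant C" "\<gamma> \<in> \<Gamma>"
  shows "\<gamma> ` C = C"
proof
  show "\<gamma> ` C \<subseteq> C"
    using assms unfolding invariant_def by blast
  show "C \<subseteq> \<gamma> ` C"
  proof
    fix x assume x: "x \<in> C"
    obtain \<gamma>' where "\<gamma>' \<in> \<Gamma>" "\<forall>x\<in>M. \<gamma> (\<gamma>' x) = x"
      using ex_inverse assms(3) by blast
    then show "x \<in> \<gamma> ` C"
      using x assms unfolding invariant_def by (metis image_eqI in_mono)
  qed
qed

lemma proj_equivariant:
  assumes C: "closed_convex C" "C \<noteq> {}" "invariant C" and \<gamma>: "\<gamma> \<in> \<Gamma>" and x: "x \<in> M"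
  shows "proj C (\<gamma> x) = \<gamma> (proj C x)"
  using proj_image[of C \<gamma> x] invariant_image[OF _ C(3) \<gamma>] closed_convexD(1)[OF C(1)]
    C \<gamma> x maps isometric by simp

lemma isometry_gp:
  assumes "\<gamma> \<in> \<Gamma>" "p \<in> M" "q \<in> M" "0 \<le> t" "t \<le> 1"
  shows "\<gamma> (gp p q t) = gp (\<gamma> p) (\<gamma> q) t"
  using assms gp_in maps isometric by (intro gp_image[where C=M]) auto

text \<open>The sublevel set of \<open>F\<close> at \<open>F y\<close> is closed, convex and
  invariant, so minimality makes it all of \<open>C\<close>. The Lipschitz bound supplies
  closedness.\<close>

lemma minimal_convex_constant:
  assumes C: "minimal C"
    and quasiconvex: "\<And>p q t. \<lbrakk>p \<in> C; q \<in> C; 0 \<le> t; t \<le> 1\<rbrakk> \<Longrightarrow> F (gp p q t) \<le> max (F p) (F q)"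
    and lipschitz: "\<And>p q. \<lbrakk>p \<in> C; q \<in> C\<rbrakk> \<Longrightarrow> F p \<le> F q + L * d p q"
    and inv: "\<And>\<gamma> p. \<lbrakk>\<gamma> \<in> \<Gamma>; p \<in> C\<rbrakk> \<Longrightarrow> F (\<gamma> p) \<le> F p"
    and "x \<in> C" "y \<in> C"
  shows "F x = (F y :: real)"
proof -
  have "F x \<le> F y" if xy: "x \<in> C" "y \<in> C" for x y
  proof -
    define D where "D = {z \<in> C. F z \<le> F y}"
    have "closed_convex D"
    proof (rule closed_convexI)
      show "D \<subseteq> M"
        using minimal_subset[OF C] by (auto simp: D_def)
      show "gp p q t \<in> D" if "p \<in> D" "q \<in> D" "0 \<le> t" "t \<le> 1" for p q t
        using quasiconvex[of p q t] closed_convexD(3)[OF minimal_closed_convex[OF C], of p q t] that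
        by (auto simp: D_def)
      show "l \<in> D" if \<sigma>: "\<And>n. \<sigma> n \<in> D" "limitin mtopology \<sigma> l sequentially" for \<sigma> l
      proof -
        have l: "l \<in> C" "l \<in> M"
          using \<sigma> closed_convexD(2)[OF minimal_closed_convex[OF C], of \<sigma> l] minimal_subset[OF C]
          by (auto simp: D_def)
        have "F l \<le> F y + L * d (\<sigma> n) l" for n
          using lipschitz[of l "\<sigma> n"] \<sigma>(1)[of n] l by (auto simp: D_def commute)
        moreover have "(\<lambda>n. F y + L * d (\<sigma> n) l) \<longlonglongrightarrow> F y + L * 0"
          using \<sigma>(2) by (intro tendsto_intros) (simp add: limitin_metric_dist_null)
        ultimately have "F l \<le> F y + L * 0"
          by (intro LIMSEQ_le_const) auto
        then show ?thesis
          using l by (simp add: D_def)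
      qed
    qed
    moreover have "invariant D"
      using inv minimal_invariant[OF C] by (fastforce simp: invariant_def D_def)
    ultimately have "D = C"
      using minimal_minimal[OF C, of D] xy by (auto simp: D_def)
    then show ?thesis
      using xy by (auto simp: D_def)
  qed
  then show ?thesis
    using \<open>x \<in> C\<close> \<open>y \<in> C\<close> by (intro order_antisym) blast+
qed

lemma minimal_dist_constant:
  assumes C: "minimal C" and D: "closed_convex D" "D \<noteq> {}" "invariant D" and "x \<in> C" "y \<in> C"
  shows "d x (proj D x) = d y (proj D y)"
proof (rule minimal_convex_constant[OF C, where L=1])
  note M = minimal_subset[OF C]
  show "d (gp p q t) (proj D (gp p q t)) \<le> max (d p (proj D p)) (d q (proj D q))"
    if "p \<in> C" "q \<in> C" "0 \<le> t" "t \<le> 1" for p q t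
    by (rule order_trans[OF dist_proj_gp[OF D(1,2)] convex_combination_le_max]) (use M that in blast)+
  show "d p (proj D p) \<le> d q (proj D q) + 1 * d p q" if "p \<in> C" "q \<in> C" for p q
    using dist_proj_diff[OF D(1,2)] M that by auto
  show "d (\<gamma> p) (proj D (\<gamma> p)) \<le> d p (proj D p)" if "\<gamma> \<in> \<Gamma>" "p \<in> C" for \<gamma> p
  proof -
    have "p \<in> M"
      using M that by auto
    then show ?thesis
      using proj_equivariant[OF D] proj_in_space[OF D(1,2)] isometric that by simp
  qed
qed (fact assms)+

lemma minimal_displacement_constant:
  assumes C: "minimal C" and e: "\<And>x. x \<in> C \<Longrightarrow> e x \<in> C"
    "\<And>x y. \<lbrakk>x \<in> C; y \<in> C\<rbrakk> \<Longrightarrow> d (e x) (e y) = d x y"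
    "\<And>\<gamma> x. \<lbrakk>\<gamma> \<in> \<Gamma>; x \<in> C\<rbrakk> \<Longrightarrow> e (\<gamma> x) = \<gamma> (e x)"
    and "x \<in> C" "y \<in> C"
  shows "d x (e x) = d y (e y)"
proof (rule minimal_convex_constant[OF C, where L=2])
  note M = minimal_subset[OF C]
  show "d (gp p q t) (e (gp p q t)) \<le> max (d p (e p)) (d q (e q))"
    if "p \<in> C" "q \<in> C" "0 \<le> t" "t \<le> 1" for p q t
  proof -
    have "e (gp p q t) = gp (e p) (e q) t"
      using that e M closed_convexD(3)[OF minimal_closed_convex[OF C]]
      by (intro gp_image[where C=C]) auto
    then have "d (gp p q t) (e (gp p q t)) \<le> (1 - t) * d p (e p) + t * d q (e q)"
      using dist_gp_gp[of p q "e p" "e q" t] e(1) M that by auto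
    then show ?thesis
      using order_trans[OF _ convex_combination_le_max] that by blast
  qed
  show "d p (e p) \<le> d q (e q) + 2 * d p q" if "p \<in> C" "q \<in> C" for p q
  proof -
    have "p \<in> M" "q \<in> M" "e p \<in> M" "e q \<in> M"
      using that e(1) M by auto
    then show ?thesis
      using triangle[of p q "e p"] triangle[of q "e q" "e p"] e(2)[OF that] commute[of "e p" "e q"] by linarith
  qed
  show "d (\<gamma> p) (e (\<gamma> p)) \<le> d p (e p)" if "\<gamma> \<in> \<Gamma>" "p \<in> C" for \<gamma> p
  proof -
    have "p \<in> M" "e p \<in> M"
      using M e(1) that by auto
    then show ?thesis
      using e(3) isometric that by simp
  qed
qed (fact assms)+

text \<open>An isometry of constant displacement \<open>\<delta>\<close> satisfies \<open>d x (e (e x)) = 2 * \<delta>\<close>: the midpoints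
  of \<open>x, e x\<close> and of \<open>e x, e (e x)\<close> are also \<open>\<delta>\<close> apart. Iterating, the orbits grow linearly.\<close>

lemma clifford_trivial:
  assumes C: "minimal C" and e: "\<And>x. x \<in> C \<Longrightarrow> e x \<in> C"
    "\<And>x y. \<lbrakk>x \<in> C; y \<in> C\<rbrakk> \<Longrightarrow> d (e x) (e y) = d x y"
    "\<And>\<gamma> x. \<lbrakk>\<gamma> \<in> \<Gamma>; x \<in> C\<rbrakk> \<Longrightarrow> e (\<gamma> x) = \<gamma> (e x)"
    and x: "x \<in> C" and bound: "\<And>n. (d x ((e ^^ n) x))\<^sup>2 \<le> real n * B" and y: "y \<in> C"
  shows "e y = y"
proof -
  note M = minimal_subset[OF C]
  have en: "(e ^^ n) z \<in> C" if "z \<in> C" for n z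
    using that e(1) by (induction n) auto
  have en_isom: "d ((e ^^ n) z) ((e ^^ n) w) = d z w" if "z \<in> C" "w \<in> C" for n z w
    using that by (induction n) (simp_all add: e(2) en)
  have en_comm: "(e ^^ n) (\<gamma> z) = \<gamma> ((e ^^ n) z)" if "\<gamma> \<in> \<Gamma>" "z \<in> C" for n z \<gamma>
    using that by (induction n) (simp_all add: e(3) en)
  define \<delta> where "\<delta> = d x (e x)"
  have double: "2 * d x ((e ^^ n) x) \<le> d x ((e ^^ (2 * n)) x)" for n
  proof -
    let ?f = "e ^^ n"
    define m where "m = gp x (?f x) (1/2)"
    have m: "m \<in> C"
      unfolding m_def using closed_convexD(3)[OF minimal_closed_convex[OF C]] x en by simp
    have CM: "x \<in> M" "?f x \<in> M" "?f (?f x) \<in> M"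
      using M x en by blast+
    \<comment> \<open>\<open>m\<close> and \<open>?f m\<close> are the midpoints of two sides that
      meet in \<open>?f x\<close>, hence at most half the third side apart.\<close>
    have "?f m = gp (?f x) (?f (?f x)) (1/2)"
      unfolding m_def using m x en en_isom M
      by (intro gp_image[where C=C]) (auto simp: m_def)
    then have "d m (?f m) \<le> (1/2) * d x (?f (?f x))"
      using dist_gp_same_left[of "?f x" x "?f (?f x)" "1/2"] CM
      by (simp add: m_def gp_commute[of x "?f x"])
    moreover have "d m (?f m) = d x (?f x)"
      using minimal_displacement_constant[OF C en en_isom en_comm m x] by blast
    moreover have "?f (?f x) = (e ^^ (2 * n)) x"
      by (simp add: mult_2 funpow_add)
    ultimately show ?thesis
      by simp
  qed
  have grow: "2 ^ k * \<delta> \<le> d x ((e ^^ (2 ^ k)) x)" for k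
  proof (induction k)
    case 0
    then show ?case by (simp add: \<delta>_def)
  next
    case (Suc k)
    then show ?case
      using double[of "2 ^ k"] by simp
  qed
  have "\<delta> = 0"
  proof (rule ccontr)
    assume "\<delta> \<noteq> 0"
    then have \<delta>: "\<delta> > 0"
      by (simp add: \<delta>_def less_le)
    \<comment> \<open>At exponent \<open>2 ^ k\<close> the squared displacement is at least
      \<open>4 ^ k * \<delta>\<^sup>2\<close> by \<open>grow\<close> and at most
      \<open>2 ^ k * B\<close> by assumption.\<close>
    have "2 ^ k * \<delta>\<^sup>2 \<le> B" for k :: nat
    proof -
      have "(2 ^ k * \<delta>)\<^sup>2 \<le> (d x ((e ^^ (2 ^ k)) x))\<^sup>2"
        using grow[of k] \<delta> by (intro power_mono) auto
      also have "\<dots> \<le> 2 ^ k * B"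
        using bound[of "2 ^ k"] by simp
      finally have "2 ^ k * (2 ^ k * \<delta>\<^sup>2) \<le> 2 ^ k * B"
        by (simp add: power2_eq_square mult_ac)
      then show ?thesis
        by simp
    qed
    moreover obtain k where "B / \<delta>\<^sup>2 < 2 ^ k"
      using real_arch_pow[of 2] by auto
    then have "B < 2 ^ k * \<delta>\<^sup>2"
      using \<delta> by (simp add: pos_divide_less_eq)
    ultimately show False
      by (simp add: not_le[symmetric])
  qed
  then have "d y (e y) = 0"
    using minimal_displacement_constant[OF C e y x] by (simp add: \<delta>_def)
  then show ?thesis
    using y e(1) M by (metis subsetD zero)
qed

text \<open>Orbits have at most two points, so the growth hypothesis of
  \<open>clifford_trivial\<close> holds with the squared displacement as constant.\<close>

corollary minimal_involution_trivial:
  assumes C: "minimal C" and e: "\<And>x. x \<in> C \<Longrightarrow> e x \<in> C"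
    "\<And>x y. \<lbrakk>x \<in> C; y \<in> C\<rbrakk> \<Longrightarrow> d (e x) (e y) = d x y"
    "\<And>\<gamma> x. \<lbrakk>\<gamma> \<in> \<Gamma>; x \<in> C\<rbrakk> \<Longrightarrow> e (\<gamma> x) = \<gamma> (e x)"
    and inv: "\<And>x. x \<in> C \<Longrightarrow> e (e x) = x" and y: "y \<in> C"
  shows "e y = y"
proof (rule clifford_trivial[OF C e y _ y])
  fix n
  have "(e ^^ n) y = (if even n then y else e y)"
    using inv y by (induction n) auto
  then show "(d y ((e ^^ n) y))\<^sup>2 \<le> real n * (d y (e y))\<^sup>2"
    using y minimal_subset[OF C] mult_right_mono[of 1 "real n" "(d y (e y))\<^sup>2"]
    by (cases n) auto
qed

text \<open>The minimal sets constructed later (between two given ones, as limits, as images under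
  the other factor) are all equivariant isometric copies of a given one. Completeness makes such a
  copy closed.\<close>

lemma minimal_isometric_image:
  assumes C: "minimal C" and e: "\<And>x. x \<in> C \<Longrightarrow> e x \<in> M"
    "\<And>x y. \<lbrakk>x \<in> C; y \<in> C\<rbrakk> \<Longrightarrow> d (e x) (e y) = d x y"
    "\<And>\<gamma> x. \<lbrakk>\<gamma> \<in> \<Gamma>; x \<in> C\<rbrakk> \<Longrightarrow> e (\<gamma> x) = \<gamma> (e x)"
  shows "minimal (e ` C)"
proof -
  note CC = minimal_closed_convex[OF C] and M = minimal_subset[OF C]
  have e_gp: "e (gp p q t) = gp (e p) (e q) t" if "p \<in> C" "q \<in> C" "0 \<le> t" "t \<le> 1" for p q t
    using that e M closed_convexD(3)[OF CC] by (intro gp_image[where C=C]) auto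
  have "closed_convex (e ` C)"
  proof (rule closed_convexI)
    show "e ` C \<subseteq> M"
      using e(1) by blast
    show "gp p q t \<in> e ` C" if pq: "p \<in> e ` C" "q \<in> e ` C" and t: "0 \<le> t" "t \<le> 1" for p q t
    proof -
      obtain p' q' where "p' \<in> C" "q' \<in> C" "p = e p'" "q = e q'"
        using pq by blast
      then show ?thesis
        using e_gp[of p' q' t] closed_convexD(3)[OF CC, of p' q' t] t by (metis image_eqI)
    qed
    show "l \<in> e ` C" if \<sigma>: "\<And>n. \<sigma> n \<in> e ` C" "limitin mtopology \<sigma> l sequentially" for \<sigma> l
    proof -
      have "\<forall>n. \<exists>y. y \<in> C \<and> \<sigma> n = e y"
        using \<sigma>(1) by blast
      then obtain \<tau> where \<tau>: "\<And>n. \<tau> n \<in> C" "\<And>n. \<sigma> n = e (\<tau> n)"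
        by metis
      have "MCauchy \<sigma>"
        using \<sigma> e(1) \<tau> by (intro convergent_imp_MCauchy) auto
      then have "MCauchy \<tau>"
        using \<tau> e(2) M unfolding MCauchy_def by auto
      then obtain k where k: "limitin mtopology \<tau> k sequentially"
        using complete by (auto simp: mcomplete_def)
      then have kC: "k \<in> C"
        using closed_convexD(2)[OF CC, of \<tau> k] \<tau> by simp
      have "limitin mtopology \<sigma> (e k) sequentially"
        using k kC e \<tau> by (simp add: limitin_metric_dist_null)
      then have "l = e k"
        using \<sigma>(2) limitin_metric_unique by (metis sequentially_bot)
      then show ?thesis
        using kC by blast
    qed
  qed
  moreover have "invariant (e ` C)"
    unfolding invariant_def using e(3) minimal_invariant[OF C] by force
  moreover have "D = e ` C"
    if D: "D \<subseteq> e ` C" "D \<noteq> {}" "closed_convex D" "invariant D" for D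
  proof -
    define D' where "D' = {x \<in> C. e x \<in> D}"
    have "D' = C"
    proof (rule minimal_minimal[OF C])
      show "D' \<subseteq> C" "D' \<noteq> {}"
        using D by (auto simp: D'_def)
      show "invariant D'"
        using D(4) e(3) minimal_invariant[OF C] by (auto simp: invariant_def D'_def)
      show "closed_convex D'"
      proof (rule closed_convexI)
        show "D' \<subseteq> M"
          using M by (auto simp: D'_def)
        show "gp p q t \<in> D'" if "p \<in> D'" "q \<in> D'" "0 \<le> t" "t \<le> 1" for p q t
          using that e_gp[of p q t] closed_convexD(3)[OF CC, of p q t] closed_convexD(3)[OF D(3), of "e p" "e q" t]
          by (simp add: D'_def)
        show "l \<in> D'" if \<sigma>: "\<And>n. \<sigma> n \<in> D'" "limitin mtopology \<sigma> l sequentially" for \<sigma> l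
        proof -
          have l: "l \<in> C"
            using closed_convexD(2)[OF CC, of \<sigma> l] \<sigma> by (auto simp: D'_def)
          have "limitin mtopology (\<lambda>n. e (\<sigma> n)) (e l) sequentially"
            using \<sigma> l e by (simp add: limitin_metric_dist_null D'_def)
          then have "e l \<in> D"
            using closed_convexD(2)[OF D(3), of "\<lambda>n. e (\<sigma> n)" "e l"] \<sigma> by (auto simp: D'_def)
          then show ?thesis
            using l by (simp add: D'_def)
        qed
      qed
    qed
    then show ?thesis
      using D(1) by (auto simp: D'_def)
  qed
  ultimately show ?thesis
    using minimal_nonempty[OF C] by (simp add: minimal_def)
qed


subsection \<open>Parallelism of minimal sets\<close>

lemma minimal_proj_in:
  assumes "minimal C" "x \<in> M"
  shows "proj C x \<in> C" "proj C x \<in> M"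
  using assms minimalD[OF assms(1)] proj_in proj_in_space by blast+

lemma minimal_proj_equivariant:
  assumes "minimal C" "\<gamma> \<in> \<Gamma>" "x \<in> M"
  shows "proj C (\<gamma> x) = \<gamma> (proj C x)"
  using assms proj_equivariant unfolding minimal_def by blast

lemma minimal_proj_lipschitz:
  assumes "minimal C" "x \<in> M" "y \<in> M"
  shows "d (proj C x) (proj C y) \<le> d x y"
  using assms proj_lipschitz unfolding minimal_def by blast

text \<open>The base point is immaterial: by \<open>minimal_dist_constant\<close>, all points of a
  minimal set are equally far from another one.\<close>

definition gap :: "'a set \<Rightarrow> 'a set \<Rightarrow> real" where
  "gap C D = d (SOME x. x \<in> C) (proj D (SOME x. x \<in> C))"

lemma dist_proj_eq_gap:
  assumes C: "minimal C" and D: "minimal D" and "x \<in> C"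
  shows "d x (proj D x) = gap C D"
  unfolding gap_def using assms D someI[of "\<lambda>x. x \<in> C"]
  by (intro minimal_dist_constant[OF C]) (auto simp: minimal_def)

lemma gap_le:
  assumes C: "minimal C" and D: "minimal D" and "x \<in> C" "y \<in> D"
  shows "gap C D \<le> d x y"
proof -
  have "d x (proj D x) \<le> d x y"
    using assms minimalD[OF D] minimal_subset[OF C] by (intro proj_le) auto
  then show ?thesis
    using dist_proj_eq_gap[OF C D] assms by simp
qed

lemma gap_commute:
  assumes C: "minimal C" and D: "minimal D"
  shows "gap C D = gap D C"
proof -
  have "gap D C \<le> gap C D" if C: "minimal C" and D: "minimal D" for C D
  proof -
    obtain x where x: "x \<in> C" "x \<in> M"
      using minimalD[OF C] by blast
    then have "gap D C \<le> d (proj D x) x"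
      using gap_le[OF D C] minimal_proj_in[OF D] by blast
    then show ?thesis
      using dist_proj_eq_gap[OF C D] x by (simp add: commute)
  qed
  then show ?thesis
    using assms by (intro order_antisym) auto
qed

text \<open>As the gap is symmetric, \<open>x\<close> already realises the distance from
  \<open>proj D x\<close> to \<open>C\<close>, and nearest points are unique.\<close>

lemma proj_proj:
  assumes C: "minimal C" and D: "minimal D" and x: "x \<in> C"
  shows "proj C (proj D x) = x"
proof (rule proj_unique)
  have M: "x \<in> M"
    using minimal_subset[OF C] x by blast
  show "closed_convex C" "x \<in> C" "proj D x \<in> M"
    using minimalD[OF C] minimal_proj_in[OF D M] x by auto
  show "d (proj D x) x \<le> d (proj D x) c" if "c \<in> C" for c
    using gap_le[OF D C minimal_proj_in(1)[OF D M] that] dist_proj_eq_gap[OF C D x] gap_commute[OF C D]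
    by (simp add: commute)
qed

text \<open>The two projections are 1-Lipschitz and inverse to each other.\<close>

lemma proj_isometric:
  assumes C: "minimal C" and D: "minimal D" and x: "x \<in> C" "y \<in> C"
  shows "d (proj D x) (proj D y) = d x y"
proof -
  have M: "x \<in> M" "y \<in> M"
    using minimal_subset[OF C] x by auto
  have "d (proj C (proj D x)) (proj C (proj D y)) \<le> d (proj D x) (proj D y)"
    using minimal_proj_lipschitz[OF C] minimal_proj_in[OF D] M by blast
  then show ?thesis
    using minimal_proj_lipschitz[OF D M] proj_proj[OF C D] x by simp
qed

text \<open>In the quadrilateral \<open>p\<close>, \<open>?y\<close>, \<open>q\<close>,
  \<open>?x\<close> opposite sides are equal. The obtuse angles at two feet bound both diagonals
  from below and the quadrilateral inequality bounds them from above, so it is metrically a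
  rectangle. This takes the place of the flat strip theorem.\<close>

lemma minimal_pythagoras:
  assumes C: "minimal C" and D: "minimal D" and p: "p \<in> C" and q: "q \<in> D"
  shows "(d p q)\<^sup>2 = (d p (proj C q))\<^sup>2 + (gap C D)\<^sup>2"
proof -
  let ?y = "proj C q" and ?x = "proj D p"
  have M: "p \<in> M" "q \<in> M"
    using minimal_subset[OF C] minimal_subset[OF D] p q by auto
  have yx: "?y \<in> C" "?y \<in> M" "?x \<in> D" "?x \<in> M"
    using minimal_proj_in C D M by auto
  have gaps: "d q ?y = gap C D" "d p ?x = gap C D"
    using dist_proj_eq_gap[OF C D p] dist_proj_eq_gap[OF D C q] gap_commute[OF C D] by auto
  have qx: "d q ?x = d p ?y"
    using proj_isometric[OF D C q yx(3)] proj_proj[OF C D p] by (simp add: commute)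
  have "(d q ?y)\<^sup>2 + (d ?y p)\<^sup>2 \<le> (d q p)\<^sup>2"
    using minimalD[OF C] M p by (intro proj_obtuse) auto
  moreover have "(d ?y q)\<^sup>2 + (d q ?x)\<^sup>2 \<le> (d ?y ?x)\<^sup>2"
    using proj_obtuse[OF minimal_closed_convex[OF D] minimal_nonempty[OF D] yx(2,3)] proj_proj[OF D C q]
    by simp
  moreover have "(d p q)\<^sup>2 + (d ?y ?x)\<^sup>2 \<le> (d p ?y)\<^sup>2 + (d ?y q)\<^sup>2 + (d q ?x)\<^sup>2 + (d p ?x)\<^sup>2"
    using M yx by (intro quadrilateral)
  ultimately show ?thesis
    unfolding qx gaps commute[of ?y q] commute[of ?y p] commute[of q p] by linarith
qed

text \<open>By Pythagoras, passing from \<open>x\<close> to \<open>proj D x\<close> adds the same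
  squared gap to the squared distances from \<open>u\<close> and from \<open>v\<close>, so it
  cancels.\<close>

lemma proj_perpendicular:
  assumes C: "minimal C" and D: "minimal D" and x: "x \<in> C" and "u \<in> C" "v \<in> C"
  shows "quasi_inner x (proj D x) u v = 0"
proof -
  have "x \<in> M"
    using minimal_subset[OF C] x by auto
  then have "(d z (proj D x))\<^sup>2 = (d z x)\<^sup>2 + (gap C D)\<^sup>2" if "z \<in> C" for z
    using minimal_pythagoras[OF C D that minimal_proj_in(1)[OF D]] proj_proj[OF C D x] by simp
  then show ?thesis
    unfolding quasi_inner_def commute[of "proj D x"] commute[of x] using assms by simp
qed

text \<open>The steps between \<open>C\<close> and the other two sets contribute nothing to the quasi-inner product
  with directions in \<open>C\<close>, so the orbits of the holonomy \<open>C \<rightarrow> D \<rightarrow> E \<rightarrow> C\<close> grow at most like a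
  square root.\<close>

lemma proj_holonomy_trivial:
  assumes C: "minimal C" and D: "minimal D" and E: "minimal E" and x: "x \<in> C"
  shows "proj C (proj E (proj D x)) = x"
proof -
  define h where "h = (\<lambda>x. proj C (proj E (proj D x)))"
  define B where "B = 2 * ((gap D E)\<^sup>2 + (gap C D)\<^sup>2)"
  have CM: "z \<in> M" if "z \<in> C" for z
    using minimal_subset[OF C] that by auto
  have h: "h z \<in> C" if "z \<in> C" for z
    unfolding h_def using minimal_proj_in C D E CM that by simp
  have h_isom: "d (h z) (h w) = d z w" if "z \<in> C" "w \<in> C" for z w
    unfolding h_def using minimal_proj_in C D E CM that by (simp add: proj_isometric)
  have h_comm: "h (\<gamma> z) = \<gamma> (h z)" if "\<gamma> \<in> \<Gamma>" "z \<in> C" for z \<gamma>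
    unfolding h_def using minimal_proj_in C D E CM that by (simp add: minimal_proj_equivariant)
  have step: "\<bar>quasi_inner z (h z) u v\<bar> \<le> B" if z: "z \<in> C" and uv: "u \<in> C" "v \<in> C" for z u v
  proof -
    define z1 z2 u1 v1 where "z1 = proj D z" and "z2 = proj E z1" and "u1 = proj D u" and "v1 = proj D v"
    have M: "z1 \<in> D" "z1 \<in> M" "z2 \<in> E" "z2 \<in> M" "u1 \<in> D" "u1 \<in> M" "v1 \<in> D" "v1 \<in> M" "u \<in> M" "v \<in> M"
      unfolding z1_def z2_def u1_def v1_def using minimal_proj_in C D E CM z uv by auto
    have hz: "h z = proj C z2"
      by (simp add: h_def z1_def z2_def)
    have "quasi_inner z z1 u v = 0"
      unfolding z1_def using proj_perpendicular[OF C D z uv] .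
    moreover have "quasi_inner (h z) z2 u v = 0"
      using proj_perpendicular[OF C E h[OF z] uv] proj_proj[OF E C M(3)] by (simp add: hz)
    moreover have "quasi_inner z1 z2 u1 v1 = 0"
      unfolding z2_def using proj_perpendicular[OF D E] M by blast
    \<comment> \<open>The middle leg from \<open>z1\<close> to \<open>z2\<close> is perpendicular to
      \<open>D\<close>, not to \<open>C\<close>; replacing \<open>u\<close>, \<open>v\<close> by
      their projections to \<open>D\<close> costs the two remaining terms, whose size does not
      depend on \<open>z\<close>, \<open>u\<close>, \<open>v\<close>.\<close>
    ultimately have "quasi_inner z (h z) u v = quasi_inner z1 z2 u u1 + quasi_inner z1 z2 v1 v"
      by (simp add: quasi_inner_def)
    moreover have "\<bar>quasi_inner z1 z2 u u1\<bar> \<le> (d z1 z2)\<^sup>2 + (d u u1)\<^sup>2"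
      "\<bar>quasi_inner z1 z2 v1 v\<bar> \<le> (d z1 z2)\<^sup>2 + (d v1 v)\<^sup>2"
      using M by (simp_all add: quasi_inner_bound)
    moreover have "d z1 z2 = gap D E" "d u u1 = gap C D" "d v1 v = gap C D"
      unfolding z2_def u1_def v1_def
      using dist_proj_eq_gap C D E M uv by (auto simp: commute[of "proj D v"])
    ultimately show ?thesis
      by (simp add: B_def)
  qed
  have hn: "(h ^^ n) x \<in> C" for n
    using x h by (induction n) auto
  have bound: "\<bar>quasi_inner x ((h ^^ n) x) u v\<bar> \<le> real n * B" if uv: "u \<in> C" "v \<in> C" for n u v
  proof (induction n)
    case 0
    then show ?case by (simp add: quasi_inner_def)
  next
    case (Suc n)
    then show ?case
      using step[OF hn uv, of n] quasi_inner_add_left[of x "(h ^^ n) x" u v "(h ^^ Suc n) x"]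
      by (simp add: algebra_simps)
  qed
  \<comment> \<open>For \<open>u = x\<close> and \<open>v = (h ^^ n) x\<close> the quasi-inner
    product is twice the squared distance, hence \<open>B / 2\<close>.\<close>
  have "(d x ((h ^^ n) x))\<^sup>2 \<le> real n * (B / 2)" for n
    using bound[OF x hn, of n n] x hn[of n] CM by (simp add: quasi_inner_def commute)
  then have "h x = x"
    using clifford_trivial[OF C h h_isom h_comm x _ x] by blast
  then show ?thesis
    by (simp add: h_def)
qed

text \<open>Apply \<open>proj C\<close> to the trivial holonomy of \<open>q\<close> along
  \<open>E\<close>, \<open>D\<close>, \<open>C\<close>, \<open>E\<close>; \<open>proj_proj\<close>
  undoes the last leg.\<close>

lemma proj_proj_proj:
  assumes C: "minimal C" and D: "minimal D" and E: "minimal E" and q: "q \<in> E"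
  shows "proj C (proj D q) = proj C q"
proof -
  have qM: "q \<in> M"
    using minimal_subset[OF E] q by auto
  have "proj C q = proj C (proj E (proj C (proj D q)))"
    using proj_holonomy_trivial[OF E D C q] by simp
  also have "\<dots> = proj C (proj D q)"
    using proj_proj[OF C E] minimal_proj_in C D qM by simp
  finally show ?thesis ..
qed

text \<open>A point of \<open>C\<close> or \<open>D\<close> closer to the interpolated point would
  give a path between the two sets shorter than their gap.\<close>

lemma interpolated_proj:
  assumes C: "minimal C" and D: "minimal D" and x: "x \<in> C" and t: "0 \<le> t" "t \<le> 1"
  shows "proj C (gp x (proj D x) t) = x" "proj D (gp x (proj D x) t) = proj D x"
    and "d x (gp x (proj D x) t) = t * gap C D" "d (gp x (proj D x) t) (proj D x) = (1 - t) * gap C D"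
proof -
  let ?y = "proj D x" and ?w = "gp x (proj D x) t"
  have M: "x \<in> M" "?y \<in> M" "?w \<in> M" and y: "?y \<in> D"
    using minimal_subset[OF C] x minimal_proj_in[OF D] gp_in t by blast+
  show 1: "d x ?w = t * gap C D" and 2: "d ?w ?y = (1 - t) * gap C D"
    using dist_gp_left[OF M(1,2) t] dist_gp_right[OF M(1,2) t] dist_proj_eq_gap[OF C D x] by auto
  show "proj C ?w = x"
  proof (rule proj_unique[OF minimal_closed_convex[OF C] M(3) x])
    fix c assume c: "c \<in> C"
    then have "gap C D \<le> d c ?w + d ?w ?y"
      using gap_le[OF C D c y] triangle[of c ?w ?y] M minimal_subset[OF C] by force
    then show "d ?w x \<le> d ?w c"
      using 1 2 by (simp add: commute algebra_simps)
  qed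
  show "proj D ?w = ?y"
  proof (rule proj_unique[OF minimal_closed_convex[OF D] M(3) y])
    fix c assume c: "c \<in> D"
    then have "gap C D \<le> d x ?w + d ?w c"
      using gap_le[OF C D x c] triangle[of x ?w c] M minimal_subset[OF D] by force
    then show "d ?w ?y \<le> d ?w c"
      using 1 2 by (simp add: algebra_simps)
  qed
qed

text \<open>Convexity of the metric shows that the interpolation does not expand; projecting back to
  \<open>C\<close> shows that it does not contract.\<close>

lemma minimal_interpolated:
  assumes C: "minimal C" and D: "minimal D" and t: "0 \<le> t" "t \<le> 1"
  shows "minimal ((\<lambda>x. gp x (proj D x) t) ` C)"
proof (rule minimal_isometric_image[OF C])
  fix x assume x: "x \<in> C"
  then have xM: "x \<in> M"
    using minimal_subset[OF C] by auto
  show w: "gp x (proj D x) t \<in> M"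
    using xM t minimal_proj_in[OF D] gp_in by simp
  show "gp (\<gamma> x) (proj D (\<gamma> x)) t = \<gamma> (gp x (proj D x) t)" if "\<gamma> \<in> \<Gamma>" for \<gamma>
    using that xM t minimal_proj_equivariant[OF D] minimal_proj_in[OF D] isometry_gp by simp
  fix y assume y: "y \<in> C"
  then have yM: "y \<in> M"
    using minimal_subset[OF C] by auto
  have "d (gp x (proj D x) t) (gp y (proj D y) t) \<le> (1 - t) * d x y + t * d (proj D x) (proj D y)"
    using xM yM t minimal_proj_in[OF D] dist_gp_gp by simp
  also have "\<dots> = d x y"
    using proj_isometric[OF C D x y] by (simp add: algebra_simps)
  finally have "d (gp x (proj D x) t) (gp y (proj D y) t) \<le> d x y" .
  moreover have "d x y \<le> d (gp x (proj D x) t) (gp y (proj D y) t)"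
    using minimal_proj_lipschitz[OF C w, of "gp y (proj D y) t"] interpolated_proj(1)[OF C D _ t] x y yM t
      minimal_proj_in[OF D] gp_in by simp
  ultimately show "d (gp x (proj D x) t) (gp y (proj D y) t) = d x y"
    by simp
qed

section \<open>Closedness and convexity of the union of the minimal sets\<close>

definition minimal_union :: "'a set" where
  "minimal_union = \<Union>{C. minimal C}"

text \<open>The point is guessed as in a Euclidean strip: go the fraction \<open>t\<close> along
  \<open>C\<close> towards the projection of \<open>q\<close>, then the fraction \<open>t\<close>
  across to \<open>D\<close>. Pythagoras verifies both distances and \<open>gp_unique\<close>
  identifies the guess.\<close>

lemma gp_in_minimal_union:
  assumes C: "minimal C" and D: "minimal D" and p: "p \<in> C" and q: "q \<in> D" and t: "0 \<le> t" "t \<le> 1"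
  shows "gp p q t \<in> minimal_union"
proof -
  define g where "g = gap C D"
  define q' where "q' = proj C q"
  define y where "y = gp p q' t"
  define w where "w = gp y (proj D y) t"
  define Ct where "Ct = (\<lambda>x. gp x (proj D x) t) ` C"
  have Ct: "minimal Ct"
    unfolding Ct_def using minimal_interpolated[OF C D t] .
  have M: "p \<in> M" "q \<in> M"
    using minimal_subset[OF C] minimal_subset[OF D] p q by auto
  have q': "q' \<in> C" "q' \<in> M"
    unfolding q'_def using minimal_proj_in[OF C] M by auto
  have y: "y \<in> C"
    unfolding y_def using closed_convexD(3)[OF minimal_closed_convex[OF C]] p q' t by simp
  have w: "w \<in> Ct" "w \<in> M"
    using y minimal_subset[OF Ct] by (auto simp: w_def Ct_def)
  note proj_w = interpolated_proj[OF C D y t, folded w_def]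
  have gC: "gap C Ct = t * g"
    using dist_proj_eq_gap[OF Ct C w(1)] proj_w gap_commute[OF C Ct] by (simp add: g_def commute)
  have gD: "gap D Ct = (1 - t) * g"
    using dist_proj_eq_gap[OF Ct D w(1)] proj_w gap_commute[OF D Ct] by (simp add: g_def)
  have pq: "(d p q)\<^sup>2 = (d p q')\<^sup>2 + g\<^sup>2"
    unfolding q'_def g_def using minimal_pythagoras[OF C D p q] .
  have "(d p w)\<^sup>2 = (d p y)\<^sup>2 + (t * g)\<^sup>2"
    using minimal_pythagoras[OF C Ct p w(1)] proj_w(1) gC by simp
  also have "d p y = t * d p q'"
    unfolding y_def using dist_gp_left M q' t by simp
  finally have "(d p w)\<^sup>2 = (t * d p q)\<^sup>2"
    using pq by (simp add: power_mult_distrib algebra_simps)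
  then have dl: "d p w = t * d p q"
    using t by (simp add: power2_eq_iff_nonneg)
  have "(d q w)\<^sup>2 = (d q (proj D y))\<^sup>2 + ((1 - t) * g)\<^sup>2"
    using minimal_pythagoras[OF D Ct q w(1)] proj_w(2) gD by simp
  also have "d q (proj D y) = d q' y"
    using proj_isometric[OF C D q'(1) y] proj_proj[OF D C q] by (simp add: q'_def)
  also have "d q' y = (1 - t) * d p q'"
    unfolding y_def using dist_gp_right M q' t by (simp add: commute)
  finally have "(d q w)\<^sup>2 = ((1 - t) * d p q)\<^sup>2"
    by (simp only: power_mult_distrib pq distrib_left)
  then have dr: "d w q = (1 - t) * d p q"
    using t by (simp add: power2_eq_iff_nonneg commute)
  have "gp p q t = w"
    using gp_unique[OF M t w(2) dl dr] by simp
  then show ?thesis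
    using w Ct by (auto simp: minimal_union_def)
qed

lemma limit_in_minimal_union:
  assumes \<sigma>: "\<And>n. \<sigma> n \<in> minimal_union" and lim: "limitin mtopology \<sigma> l sequentially"
  shows "l \<in> minimal_union"
proof -
  have "\<forall>n. \<exists>C. minimal C \<and> \<sigma> n \<in> C"
    using \<sigma> by (auto simp: minimal_union_def)
  then obtain K where K: "\<And>n. minimal (K n)" "\<And>n. \<sigma> n \<in> K n"
    by metis
  define C where "C = K 0"
  have C: "minimal C"
    using K by (simp add: C_def)
  have M: "\<sigma> n \<in> M" "z \<in> C \<Longrightarrow> z \<in> M" for n z
    using K minimal_subset C by blast+
  have lM: "l \<in> M"
    using lim by (simp add: limitin_metric_dist_null)
  have diff: "d (proj (K n) x) (proj (K m) x) \<le> d (\<sigma> n) (\<sigma> m)" if x: "x \<in> C" for n m x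
  proof -
    have "proj (K m) (proj (K n) x) = proj (K m) x"
      using proj_proj_proj[OF K(1) K(1) C x] .
    then have "d (proj (K n) x) (proj (K m) x) = gap (K n) (K m)"
      using dist_proj_eq_gap[OF K(1) K(1)] minimal_proj_in[OF K(1) M(2)[OF x]] by metis
    then show ?thesis
      using gap_le[OF K(1) K(1) K(2) K(2)] by simp
  qed
  have "\<exists>y. limitin mtopology (\<lambda>n. proj (K n) x) y sequentially" if x: "x \<in> C" for x
  proof -
    have "MCauchy \<sigma>"
      using lim M by (intro convergent_imp_MCauchy) auto
    have "MCauchy (\<lambda>n. proj (K n) x)"
      unfolding MCauchy_def
    proof (intro conjI allI impI)
      show "range (\<lambda>n. proj (K n) x) \<subseteq> M"
        using minimal_proj_in(2)[OF K(1) M(2)[OF x]] by blast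
      fix \<epsilon> :: real assume "\<epsilon> > 0"
      then obtain N where "\<And>n n'. \<lbrakk>N \<le> n; N \<le> n'\<rbrakk> \<Longrightarrow> d (\<sigma> n) (\<sigma> n') < \<epsilon>"
        using \<open>MCauchy \<sigma>\<close> unfolding MCauchy_def by blast
      then show "\<exists>N. \<forall>n n'. N \<le> n \<longrightarrow> N \<le> n' \<longrightarrow> d (proj (K n) x) (proj (K n') x) < \<epsilon>"
        using diff[OF x] le_less_trans by blast
    qed
    then show ?thesis
      using complete by (simp add: mcomplete_def)
  qed
  then obtain e where e: "\<And>x. x \<in> C \<Longrightarrow> limitin mtopology (\<lambda>n. proj (K n) x) (e x) sequentially"
    by metis
  have PM: "proj (K n) x \<in> M" if "x \<in> C" for n x
    using minimal_proj_in(2)[OF K(1) M(2)[OF that]] .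
  have eM: "e x \<in> M" if "x \<in> C" for x
    using e[OF that] by (simp add: limitin_metric_dist_null)
  have "minimal (e ` C)"
  proof (rule minimal_isometric_image[OF C eM])
    show "d (e x) (e y) = d x y" if "x \<in> C" "y \<in> C" for x y
    proof -
      have "(\<lambda>n. d (proj (K n) x) (proj (K n) y)) \<longlonglongrightarrow> d (e x) (e y)"
        using e that PM by (intro tendsto_dist) auto
      then show ?thesis
        using proj_isometric[OF C K(1)] that by (simp add: LIMSEQ_const_iff)
    qed
    show "e (\<gamma> x) = \<gamma> (e x)" if "\<gamma> \<in> \<Gamma>" "x \<in> C" for \<gamma> x
    proof -
      have "limitin mtopology (\<lambda>n. proj (K n) (\<gamma> x)) (\<gamma> (e x)) sequentially"
        using e[OF that(2)] that PM eM maps isometric minimal_proj_equivariant[OF K(1)] M(2)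
        by (simp add: limitin_metric_dist_null)
      moreover have "limitin mtopology (\<lambda>n. proj (K n) (\<gamma> x)) (e (\<gamma> x)) sequentially"
        using e minimal_invariant[OF C] that by blast
      ultimately show ?thesis
        using limitin_metric_unique by (metis sequentially_bot)
    qed
  qed
  moreover have "l \<in> e ` C"
  proof -
    define c where "c = proj C l"
    have c: "c \<in> C"
      unfolding c_def using minimal_proj_in[OF C lM] by simp
    \<comment> \<open>Seen from \<open>C\<close>, the points \<open>proj (K n) c\<close> and
      \<sigma> \<open>n\<close> are the projections of \<open>l\<close> and \<sigma>
      \<open>n\<close>; hence they get arbitrarily close, and \<open>e c\<close> must be
      \<open>l\<close>.\<close>
    have near: "d (proj (K n) c) (\<sigma> n) \<le> d (\<sigma> n) l" for n
    proof -
      have "proj (K n) (proj C (\<sigma> n)) = \<sigma> n"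
        using proj_proj[OF K(1) C K(2)] .
      then have "d (proj (K n) c) (\<sigma> n) = d c (proj C (\<sigma> n))"
        using proj_isometric[OF C K(1) c] minimal_proj_in[OF C M(1)] by metis
      also have "\<dots> \<le> d l (\<sigma> n)"
        unfolding c_def using minimal_proj_lipschitz[OF C lM M(1)] .
      finally show ?thesis
        by (simp add: commute)
    qed
    have "(\<lambda>n. d (proj (K n) c) (\<sigma> n)) \<longlonglongrightarrow> d (e c) l"
      using e c PM M lim by (intro tendsto_dist) auto
    moreover have "(\<lambda>n. d (\<sigma> n) l) \<longlonglongrightarrow> 0"
      using lim by (simp add: limitin_metric_dist_null)
    ultimately have "d (e c) l \<le> 0"
      using near LIMSEQ_le by blast
    then have "d (e c) l = 0"
      using nonneg[of "e c" l] by linarith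
    then have "e c = l"
      using eM[OF c] lM by simp
    then show ?thesis
      using c by blast
  qed
  ultimately show ?thesis
    by (auto simp: minimal_union_def)
qed

lemma closed_convex_minimal_union: "closed_convex minimal_union"
proof (rule closed_convexI)
  show "minimal_union \<subseteq> M"
    using minimal_subset by (auto simp: minimal_union_def)
  show "gp p q t \<in> minimal_union" if "p \<in> minimal_union" "q \<in> minimal_union" "0 \<le> t" "t \<le> 1" for p q t
    using that gp_in_minimal_union unfolding minimal_union_def by blast
qed (rule limit_in_minimal_union)


text \<open>Zorn's lemma on invariant subsets. Each candidate can be moved into \<open>K\<close>
  while staying inside itself, so it meets the compact set; the finite intersection property keeps
  intersections of chains nonempty.\<close>

lemma ex_minimal:
  assumes Y: "closed_convex Y" "invariant Y" "Y \<noteq> {}"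
    and K: "compactin mtopology K" and cover: "\<And>x. x \<in> Y \<Longrightarrow> \<exists>\<gamma>\<in>\<Gamma>. \<gamma> x \<in> K"
  obtains C where "minimal C" "C \<subseteq> Y"
proof -
  define A where "A = {D. D \<subseteq> Y \<and> D \<noteq> {} \<and> closed_convex D \<and> invariant D}"
  have meets: "K \<inter> D \<noteq> {}" if "D \<in> A" for D
    using that cover unfolding A_def invariant_def by blast
  have "\<exists>m\<in>A. \<forall>a\<in>A. a \<subseteq> m \<longrightarrow> a = m"
  proof (rule predicate_Zorn[of A "\<lambda>a b. b \<subseteq> a"])
    show "partial_order_on A (relation_of (\<lambda>a b. b \<subseteq> a) A)"
      by (rule partial_order_on_relation_ofI) auto
    fix \<C> assume chain: "\<C> \<in> Chains (relation_of (\<lambda>a b. b \<subseteq> a) A)"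
    then have sub: "\<C> \<subseteq> A" and total: "\<And>a b. \<lbrakk>a \<in> \<C>; b \<in> \<C>\<rbrakk> \<Longrightarrow> a \<subseteq> b \<or> b \<subseteq> a"
      unfolding Chains_def relation_of_def by blast+
    show "\<exists>u\<in>A. \<forall>a\<in>\<C>. u \<subseteq> a"
    proof (cases "\<C> = {}")
      case True
      then show ?thesis
        using Y by (auto simp: A_def)
    next
      case False
      have inter_in: "\<Inter>\<F> \<in> \<F>" if "finite \<F>" "\<F> \<noteq> {}" "\<F> \<subseteq> \<C>" for \<F>
        using that
      proof (induction rule: finite_ne_induct)
        case (insert a \<F>)
        then have "a \<subseteq> \<Inter>\<F> \<or> \<Inter>\<F> \<subseteq> a"
          using total by blast
        then have "\<Inter>(insert a \<F>) = a \<or> \<Inter>(insert a \<F>) = \<Inter>\<F>"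
          by auto
        then show ?case
          using insert by auto
      qed auto
      have "K \<inter> \<Inter>\<F> \<noteq> {}" if \<F>: "finite \<F>" "\<F> \<subseteq> \<C>" for \<F>
      proof (cases "\<F> = {}")
        case True
        obtain D where "D \<in> A"
          using sub False by blast
        then show ?thesis
          using meets[of D] True by auto
      next
        case nonempty: False
        then show ?thesis
          using meets inter_in[OF \<F>(1) nonempty \<F>(2)] \<F>(2) sub by blast
      qed
      moreover have "closedin mtopology a" if "a \<in> \<C>" for a
        using that sub by (auto simp: A_def closed_convex_def)
      ultimately have "K \<inter> \<Inter>\<C> \<noteq> {}"
        using conjunct2[OF K[unfolded compactin_fip], rule_format, of \<C>] by simp
      moreover have "closed_convex (\<Inter>\<C>)"
        using sub False by (intro closed_convex_Inter) (auto simp: A_def)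
      moreover have "invariant (\<Inter>\<C>)"
        using sub unfolding A_def invariant_def by blast
      moreover have "\<Inter>\<C> \<subseteq> Y"
        using sub False by (auto simp: A_def)
      ultimately have "\<Inter>\<C> \<in> A"
        unfolding A_def by blast
      then show ?thesis
        by blast
    qed
  qed
  then obtain C where C: "C \<in> A" "\<And>D. \<lbrakk>D \<in> A; D \<subseteq> C\<rbrakk> \<Longrightarrow> D = C"
    by blast
  have "minimal C"
    unfolding minimal_def
  proof (intro conjI allI impI)
    show "closed_convex C" "C \<noteq> {}" "invariant C"
      using C(1) by (auto simp: A_def)
    fix D assume D: "D \<subseteq> C \<and> D \<noteq> {} \<and> closed_convex D \<and> invariant D"
    then have "D \<in> A"
      using C(1) by (auto simp: A_def)
    then show "D = C"
      using C(2) D by blast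
  qed
  then show thesis
    using that C(1) by (auto simp: A_def)
qed

subsection \<open>The product decomposition of the union of the minimal sets\<close>

lemma minimal_disjoint:
  assumes C: "minimal C" and D: "minimal D" and p: "p \<in> C" "p \<in> D"
  shows "C = D"
proof -
  have "C \<subseteq> D" if C: "minimal C" and D: "minimal D" and p: "p \<in> C" "p \<in> D" for C D
  proof
    fix x assume x: "x \<in> C"
    have M: "p \<in> M" "x \<in> M"
      using minimal_subset[OF C] p x by auto
    have "d x (proj D x) = d p (proj D p)"
      using dist_proj_eq_gap[OF C D] x p by simp
    also have "\<dots> = 0"
      using proj_self[OF minimal_closed_convex[OF D] p(2)] M by simp
    finally have "x = proj D x"
      using M minimal_proj_in[OF D] by simp
    then show "x \<in> D"
      using minimal_proj_in[OF D M(2)] by simp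
  qed
  then show ?thesis
    using assms by blast
qed

text \<open>The leaf through \<open>p\<close> of the partition into minimal sets, later the copy of
  the first factor through \<open>p\<close>.\<close>

definition cell :: "'a \<Rightarrow> 'a set" where
  "cell p = (THE C. minimal C \<and> p \<in> C)"

lemma cell_eq:
  assumes "minimal C" "p \<in> C"
  shows "cell p = C"
  unfolding cell_def using assms minimal_disjoint by (intro the_equality) auto

lemma cell_props:
  assumes "p \<in> minimal_union"
  shows minimal_cell: "minimal (cell p)" and in_cell: "p \<in> cell p"
  using assms cell_eq by (auto simp: minimal_union_def)

lemma minimal_union_subset: "minimal_union \<subseteq> M"
  using minimal_subset by (auto simp: minimal_union_def)

lemma minimal_subset_union: "minimal C \<Longrightarrow> C \<subseteq> minimal_union"
  by (auto simp: minimal_union_def)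

lemma proj_cell:
  assumes C: "minimal C" and c: "c \<in> C" and p: "p \<in> minimal_union"
  shows "proj (cell p) c \<in> cell p" "proj (cell p) c \<in> minimal_union" "proj (cell p) c \<in> M"
    "proj C (proj (cell p) c) = c" "cell (proj (cell p) c) = cell p"
proof -
  have cM: "c \<in> M"
    using minimal_subset[OF C] c by blast
  show *: "proj (cell p) c \<in> cell p" "proj (cell p) c \<in> M"
    using minimal_proj_in[OF minimal_cell[OF p] cM] by auto
  show "proj (cell p) c \<in> minimal_union"
    using * minimal_subset_union[OF minimal_cell[OF p]] by blast
  show "proj C (proj (cell p) c) = c"
    using proj_proj[OF C minimal_cell[OF p] c] .
  show "cell (proj (cell p) c) = cell p"
    using cell_eq[OF minimal_cell[OF p] *(1)] .
qed

lemma proj_cell_proj: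
  assumes C: "minimal C" and p: "p \<in> minimal_union"
  shows "proj (cell p) (proj C p) = p"
  using proj_proj[OF minimal_cell[OF p] C in_cell[OF p]] .

lemma dist_proj_cell:
  assumes C: "minimal C" and c: "c \<in> C" and p: "p \<in> minimal_union" and q: "q \<in> minimal_union"
  shows "d (proj (cell p) c) (proj (cell q) c) = gap (cell p) (cell q)"
proof -
  have "proj (cell q) (proj (cell p) c) = proj (cell q) c"
    using proj_proj_proj[OF minimal_cell[OF q] minimal_cell[OF p] C c] .
  then show ?thesis
    using dist_proj_eq_gap[OF minimal_cell[OF p] minimal_cell[OF q] proj_cell(1)[OF C c p]] by simp
qed

text \<open>Pythagoras between the cells of \<open>p\<close> and \<open>q\<close>: the part along
  the cells is carried isometrically to \<open>C\<close>, and the part across is the gap, which is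
  also the distance of the two points over \<open>c\<close>.\<close>

lemma minimal_union_dist:
  assumes C: "minimal C" and c: "c \<in> C" and p: "p \<in> minimal_union" and q: "q \<in> minimal_union"
  shows "(d p q)\<^sup>2 = (d (proj C p) (proj C q))\<^sup>2 + (d (proj (cell p) c) (proj (cell q) c))\<^sup>2"
proof -
  note P = minimal_cell[OF p] and Q = minimal_cell[OF q]
  have qM: "q \<in> M"
    using q minimal_union_subset by blast
  have "(d p q)\<^sup>2 = (d p (proj (cell p) q))\<^sup>2 + (gap (cell p) (cell q))\<^sup>2"
    using minimal_pythagoras[OF P Q in_cell[OF p] in_cell[OF q]] .
  also have "d p (proj (cell p) q) = d (proj C p) (proj C (proj (cell p) q))"
    using proj_isometric[OF P C in_cell[OF p] minimal_proj_in(1)[OF P qM]] by simp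
  also have "proj C (proj (cell p) q) = proj C q"
    using proj_proj_proj[OF C P Q in_cell[OF q]] .
  finally show ?thesis
    using dist_proj_cell[OF C c p q] by simp
qed

text \<open>For \<open>c\<close> in a minimal \<open>C\<close> this is a cross-section: it meets the
  cell of each \<open>p\<close> only in \<open>proj (cell p) c\<close>.\<close>

definition fibre :: "'a set \<Rightarrow> 'a \<Rightarrow> 'a set" where
  "fibre C c = {p \<in> minimal_union. proj C p = c}"

text \<open>The inverse sends \<open>(a, t)\<close> to \<open>proj (cell t) a\<close>.\<close>

lemma bij_betw_minimal_union:
  assumes C: "minimal C" and c: "c \<in> C"
  shows "bij_betw (\<lambda>p. (proj C p, proj (cell p) c)) minimal_union (C \<times> fibre C c)"
proof (rule bij_betwI')
  show "(proj C p, proj (cell p) c) = (proj C q, proj (cell q) c) \<longleftrightarrow> p = q"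
    if "p \<in> minimal_union" "q \<in> minimal_union" for p q
  proof
    assume *: "(proj C p, proj (cell p) c) = (proj C q, proj (cell q) c)"
    then have "cell p = cell q"
      using proj_cell(5)[OF C c] that by (metis prod.inject)
    then show "p = q"
      using * proj_cell_proj[OF C] that by (metis prod.inject)
  qed auto
  show "(proj C p, proj (cell p) c) \<in> C \<times> fibre C c" if "p \<in> minimal_union" for p
    using minimal_proj_in[OF C] minimal_union_subset proj_cell[OF C c] that by (auto simp: fibre_def)
  show "\<exists>p\<in>minimal_union. y = (proj C p, proj (cell p) c)" if y: "y \<in> C \<times> fibre C c" for y
  proof -
    obtain a t where at: "y = (a, t)" "a \<in> C" "t \<in> minimal_union" "proj C t = c"
      using y by (auto simp: fibre_def)
    note p = proj_cell[OF C at(2,3)]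
    have "proj (cell t) c = t"
      using proj_cell_proj[OF C at(3)] at(4) by simp
    then show ?thesis
      using p at by (intro bexI[of _ "proj (cell t) a"]) auto
  qed
qed

subsection \<open>Isometries commuting with the given ones\<close>

definition centralising :: "('a \<Rightarrow> 'a) \<Rightarrow> bool" where
  "centralising k \<longleftrightarrow> (\<forall>x\<in>M. k x \<in> M) \<and> (\<forall>x\<in>M. \<forall>y\<in>M. d (k x) (k y) = d x y) \<and>
     (\<forall>\<gamma>\<in>\<Gamma>. \<forall>x\<in>M. k (\<gamma> x) = \<gamma> (k x))"

lemma centralisingD:
  assumes "centralising k"
  shows "\<And>x. x \<in> M \<Longrightarrow> k x \<in> M" "\<And>x y. \<lbrakk>x \<in> M; y \<in> M\<rbrakk> \<Longrightarrow> d (k x) (k y) = d x y"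
    "\<And>\<gamma> x. \<lbrakk>\<gamma> \<in> \<Gamma>; x \<in> M\<rbrakk> \<Longrightarrow> k (\<gamma> x) = \<gamma> (k x)"
  using assms by (auto simp: centralising_def)

lemma minimal_image:
  assumes k: "centralising k" and C: "minimal C"
  shows "minimal (k ` C)"
proof (rule minimal_isometric_image[OF C])
  note CM = subsetD[OF minimal_subset[OF C]]
  show "k x \<in> M" if "x \<in> C" for x
    using centralisingD(1)[OF k CM[OF that]] .
  show "d (k x) (k y) = d x y" if "x \<in> C" "y \<in> C" for x y
    using centralisingD(2)[OF k CM CM] that .
  show "k (\<gamma> x) = \<gamma> (k x)" if "\<gamma> \<in> \<Gamma>" "x \<in> C" for \<gamma> x
    using centralisingD(3)[OF k that(1) CM[OF that(2)]] .
qed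

lemma centralising_cell:
  assumes k: "centralising k" and p: "p \<in> minimal_union"
  shows "cell (k p) = k ` cell p" "k p \<in> minimal_union"
proof -
  have *: "minimal (k ` cell p)" "k p \<in> k ` cell p"
    using minimal_image[OF k minimal_cell[OF p]] in_cell[OF p] by auto
  show "cell (k p) = k ` cell p"
    using cell_eq[OF *] .
  show "k p \<in> minimal_union"
    using * minimal_subset_union by blast
qed

lemma proj_centralising_image:
  assumes k: "centralising k" and C: "minimal C" and x: "x \<in> M"
  shows "proj (k ` C) (k x) = k (proj C x)"
  using minimalD[OF C] minimalD[OF minimal_image[OF k C]] centralisingD[OF k] x
  by (intro proj_image) auto

lemma proj_centralising_proj:
  assumes k: "centralising k" and C: "minimal C" and p: "p \<in> minimal_union"
  shows "proj C (k (proj C p)) = proj C (k p)"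
proof -
  have "p \<in> M"
    using p minimal_union_subset by blast
  then have "proj C (k (proj C p)) = proj C (proj (k ` C) (k p))"
    using proj_centralising_image[OF k C] by simp
  also have "\<dots> = proj C (k p)"
    using proj_proj_proj[OF C minimal_image[OF k C] minimal_cell in_cell] centralising_cell[OF k p] by blast
  finally show ?thesis .
qed

text \<open>The map induced on the first factor, \<open>k\<close> followed by \<open>proj C\<close>,
  is itself an involution of \<open>C\<close> commuting with the group, so minimality forces it to
  be the identity.\<close>

lemma proj_centralising_involution:
  assumes k: "centralising k" and inv: "\<And>x. x \<in> M \<Longrightarrow> k (k x) = x"
    and C: "minimal C" and p: "p \<in> minimal_union"
  shows "proj C (k p) = proj C p"
proof -
  note CU = subsetD[OF minimal_subset_union[OF C]] and CM = subsetD[OF minimal_subset[OF C]]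
  have "proj C (k (proj C p)) = proj C p"
  proof (rule minimal_involution_trivial[OF C, of "\<lambda>x. proj C (k x)"])
    show "proj C (k x) \<in> C" if "x \<in> C" for x
      using minimal_proj_in[OF C] centralisingD(1)[OF k] CM that by blast
    show "d (proj C (k x)) (proj C (k y)) = d x y" if "x \<in> C" "y \<in> C" for x y
      using proj_isometric[OF minimal_image[OF k C] C] centralisingD(2)[OF k] CM that by simp
    show "proj C (k (\<gamma> x)) = \<gamma> (proj C (k x))" if "\<gamma> \<in> \<Gamma>" "x \<in> C" for \<gamma> x
      using centralisingD[OF k] CM that minimal_proj_equivariant[OF C] by simp
    show "proj C (k (proj C (k x))) = x" if "x \<in> C" for x
      using proj_centralising_proj[OF k C centralising_cell(2)[OF k CU[OF that]]] inv[OF CM[OF that]]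
        proj_self[OF minimal_closed_convex[OF C] that] by simp
    show "proj C p \<in> C"
      using minimal_proj_in[OF C] p minimal_union_subset by blast
  qed
  then show ?thesis
    using proj_centralising_proj[OF k C p] by simp
qed

lemma invariant_cell:
  assumes \<gamma>: "\<gamma> \<in> \<Gamma>" and p: "p \<in> minimal_union"
  shows "cell (\<gamma> p) = cell p" "\<gamma> p \<in> minimal_union"
  using cell_eq[OF minimal_cell[OF p]] minimal_invariant[OF minimal_cell[OF p] \<gamma> in_cell[OF p]]
    minimal_subset_union[OF minimal_cell[OF p]] by auto

lemma proj_cell_centralising:
  assumes k: "centralising k" and C: "minimal C" and c: "c \<in> C" and p: "p \<in> minimal_union"
  shows "proj (cell (k (proj (cell p) c))) c = proj (cell (k p)) c"
  using centralising_cell(1)[OF k] p proj_cell[OF C c p] by simp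

lemma dist_proj_cell_centralising:
  assumes k: "centralising k" and C: "minimal C" and c: "c \<in> C"
    and p: "p \<in> minimal_union" and q: "q \<in> minimal_union"
  shows "d (proj (cell (k p)) c) (proj (cell (k q)) c) = d (proj (cell p) c) (proj (cell q) c)"
proof -
  note kp = centralising_cell[OF k p] and kq = centralising_cell[OF k q]
  have pM: "p \<in> M"
    using p minimal_union_subset by blast
  have "gap (cell (k p)) (cell (k q)) = d (k p) (proj (k ` cell q) (k p))"
    using dist_proj_eq_gap[OF minimal_cell[OF kp(2)] minimal_cell[OF kq(2)] in_cell[OF kp(2)]] kq(1) by simp
  also have "\<dots> = gap (cell p) (cell q)"
    using proj_centralising_image[OF k minimal_cell[OF q] pM] centralisingD(2)[OF k] pM
      minimal_proj_in[OF minimal_cell[OF q] pM]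
      dist_proj_eq_gap[OF minimal_cell[OF p] minimal_cell[OF q] in_cell[OF p]] by simp
  finally show ?thesis
    using dist_proj_cell[OF C c p q] dist_proj_cell[OF C c kp(2) kq(2)] by simp
qed

end

section \<open>Geometric actions on CAT(0) spaces\<close>

lemma ex_comparison_triangle:
  fixes a b c :: real
  assumes "0 \<le> a" "0 \<le> b" "0 \<le> c" "a \<le> b + c" "b \<le> a + c" "c \<le> a + b"
  obtains p q r :: "real^2" where "dist p q = a" "dist q r = b" "dist r p = c"
proof -
  have dist2: "dist (vector [x, y] :: real^2) (vector [x', y']) = sqrt ((x - x')\<^sup>2 + (y - y')\<^sup>2)"
    for x y x' y' :: real
    by (simp add: dist_vec_def L2_set_def sum_2 dist_real_def)
  show thesis
  proof (cases "a = 0")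
    case True
    then have "b = c"
      using assms by simp
    then show thesis
      using that[of 0 0 "vector [c, 0]"] dist2[of c 0 0 0] dist2[of 0 0 c 0] True assms
      by (metis abs_of_nonneg add.right_neutral diff_zero dist_commute dist_self dist2
          power_zero_numeral real_sqrt_abs that)
  next
    case False
    then have a: "a > 0"
      using assms by simp
    \<comment> \<open>The law of cosines gives the abscissa of the third vertex; the triangle
      inequalities amount to \<open>\<bar>x\<bar> \<le> c\<close>, so that \<open>y\<close> is an
      honest square root.\<close>
    define x where "x = (a\<^sup>2 + c\<^sup>2 - b\<^sup>2) / (2 * a)"
    define y where "y = sqrt (c\<^sup>2 - x\<^sup>2)"
    have ax: "2 * a * x = a\<^sup>2 + c\<^sup>2 - b\<^sup>2"
      using a by (simp add: x_def)
    have "b\<^sup>2 \<le> (a + c)\<^sup>2" "(a - c)\<^sup>2 \<le> b\<^sup>2"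
      using assms by (simp_all add: power_mono abs_le_square_iff[symmetric])
    then have "2 * a * x \<le> 2 * a * c" "2 * a * (- c) \<le> 2 * a * x"
      unfolding ax by (simp_all add: power2_eq_square algebra_simps)
    then have "x \<le> c" "- c \<le> x"
      using a by (simp_all only: mult_le_cancel_left_pos zero_less_numeral zero_less_mult_iff simp_thms)
    then have "x\<^sup>2 \<le> c\<^sup>2"
      by (simp add: abs_le_square_iff[symmetric])
    then have y: "y\<^sup>2 = c\<^sup>2 - x\<^sup>2"
      by (simp add: y_def)
    show thesis
    proof (rule that[of "vector [0, 0]" "vector [a, 0]" "vector [x, y]"])
      show "dist (vector [0, 0]) (vector [a, 0] :: real^2) = a"
        using a by (simp add: dist2)
      have "(a - x)\<^sup>2 + y\<^sup>2 = b\<^sup>2"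
        using ax y by (simp add: power2_eq_square algebra_simps)
      then show "dist (vector [a, 0]) (vector [x, y] :: real^2) = b"
        using assms by (simp add: dist2)
      show "dist (vector [x, y]) (vector [0, 0] :: real^2) = c"
        using y assms by (simp add: dist2)
    qed
  qed
qed

text \<open>Stewart's theorem: the Euclidean case of CN, with equality.\<close>

lemma dist_affine_combination:
  fixes p q r :: "'v::real_inner"
  shows "(dist r (p + t *\<^sub>R (q - p)))\<^sup>2
    = (1 - t) * (dist r p)\<^sup>2 + t * (dist r q)\<^sup>2 - t * (1 - t) * (dist p q)\<^sup>2"
  by (simp add: dist_norm power2_norm_eq_inner inner_diff_left inner_diff_right inner_add_left
      inner_add_right inner_commute algebra_simps)

lemma geodesic_pointE:
  assumes "geodesic_space X" "p \<in> mspace X" "q \<in> mspace X"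
  obtains \<sigma> c where "geodesic_segment X p q \<sigma>" "\<And>s. \<lbrakk>0 \<le> s; s \<le> mdist X p q\<rbrakk> \<Longrightarrow>
    c s \<in> \<sigma> \<and> c s \<in> mspace X \<and> mdist X p (c s) = s \<and> mdist X (c s) q = mdist X p q - s"
proof -
  obtain \<sigma> where \<sigma>: "geodesic_segment X p q \<sigma>"
    using assms by (auto simp: geodesic_space_def)
  then obtain c l where c: "0 \<le> l" "c 0 = p" "c l = q" "\<sigma> = c ` {0..l}" "\<sigma> \<subseteq> mspace X"
    "\<And>s t. \<lbrakk>s \<in> {0..l}; t \<in> {0..l}\<rbrakk> \<Longrightarrow> mdist X (c s) (c t) = \<bar>s - t\<bar>"
    unfolding geodesic_segment_def by blast
  have l: "mdist X p q = l"
    using c(6)[of 0 l] c by simp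
  show thesis
  proof (rule that[OF \<sigma>, of c])
    fix s assume s: "0 \<le> s" "s \<le> mdist X p q"
    then have "c s \<in> \<sigma>"
      using c(4) l by auto
    then show "c s \<in> \<sigma> \<and> c s \<in> mspace X \<and> mdist X p (c s) = s \<and> mdist X (c s) q = mdist X p q - s"
      using c(5) c(6)[of 0 s] c(6)[of s l] c(1-3) s l by auto
  qed
qed

lemma geodesic_segment_subset:
  assumes "geodesic_segment X p q \<sigma>"
  shows "\<sigma> \<subseteq> mspace X" "p \<in> \<sigma>" "q \<in> \<sigma>"
proof -
  obtain c l where "0 \<le> (l::real)" "c 0 = p" "c l = q" "\<sigma> = c ` {0..l}" "\<sigma> \<subseteq> mspace X"
    using assms unfolding geodesic_segment_def by blast
  then show "\<sigma> \<subseteq> mspace X" "p \<in> \<sigma>" "q \<in> \<sigma>"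
    using image_eqI[of p c 0 "{0..l}"] image_eqI[of q c l "{0..l}"] by simp_all
qed

lemma CAT0_geodesic_point:
  assumes X: "CAT0 X" and M: "p \<in> mspace X" "q \<in> mspace X" and t: "0 \<le> t" "t \<le> 1"
  shows "\<exists>m\<in>mspace X. mdist X p m = t * mdist X p q \<and> mdist X m q = (1 - t) * mdist X p q \<and>
    (\<forall>r\<in>mspace X. (mdist X r m)\<^sup>2 \<le>
       (1 - t) * (mdist X r p)\<^sup>2 + t * (mdist X r q)\<^sup>2 - t * (1 - t) * (mdist X p q)\<^sup>2)"
proof -
  have geo: "geodesic_space X"
    using X by (simp add: CAT0_def)
  obtain \<sigma> c where \<sigma>: "geodesic_segment X p q \<sigma>" and c: "\<And>s. \<lbrakk>0 \<le> s; s \<le> mdist X p q\<rbrakk> \<Longrightarrow>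
    c s \<in> \<sigma> \<and> c s \<in> mspace X \<and> mdist X p (c s) = s \<and> mdist X (c s) q = mdist X p q - s"
    using geodesic_pointE[OF geo M] by blast
  define m where "m = c (t * mdist X p q)"
  have "t * mdist X p q \<le> mdist X p q"
    using t mult_left_le_one_le[of "mdist X p q" t] by simp
  then have m: "m \<in> \<sigma>" "m \<in> mspace X" "mdist X p m = t * mdist X p q" "mdist X m q = (1 - t) * mdist X p q"
    using c[of "t * mdist X p q"] t by (simp_all add: m_def left_diff_distrib)
  have "(mdist X r m)\<^sup>2 \<le>
       (1 - t) * (mdist X r p)\<^sup>2 + t * (mdist X r q)\<^sup>2 - t * (1 - t) * (mdist X p q)\<^sup>2"
    if r: "r \<in> mspace X" for r
  proof -
    obtain \<tau> \<rho> where \<tau>: "geodesic_segment X q r \<tau>" and \<rho>: "geodesic_segment X r p \<rho>"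
      using geo M r unfolding geodesic_space_def by blast
    obtain p' q' r' :: "real^2" where
      tri: "dist p' q' = mdist X p q" "dist q' r' = mdist X q r" "dist r' p' = mdist X r p"
      using ex_comparison_triangle[of "mdist X p q" "mdist X q r" "mdist X r p"] M r
        mdist_triangle[of p X r q] mdist_triangle[of q X p r] mdist_triangle[of r X q p]
      by (metis add.commute mdist_commute mdist_nonneg)
    define m' where "m' = p' + t *\<^sub>R (q' - p')"
    have "m' \<in> closed_segment p' q'"
      using t unfolding m'_def closed_segment_def by (auto intro!: exI[of _ t] simp: algebra_simps)
    moreover have "dist p' m' = mdist X p m"
      using t tri(1) m(3) by (simp add: m'_def dist_norm norm_minus_commute)
    ultimately have "comparison_point X p \<sigma> p' q' m m'"
      using m(1) by (simp add: comparison_point_def)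
    \<comment> \<open>The vertex \<open>r\<close> counts as a point of the side from
      \<open>q\<close> to \<open>r\<close>, which brings a vertex-to-side distance under the CAT(0)
      condition.\<close>
    moreover have "comparison_point X q \<tau> q' r' r r'"
      using geodesic_segment_subset[OF \<tau>] tri(2) by (simp add: comparison_point_def)
    ultimately have "mdist X r m \<le> dist r' m'"
      using X \<sigma> \<tau> \<rho> tri unfolding CAT0_def Let_def by blast
    then have "(mdist X r m)\<^sup>2 \<le> (dist r' m')\<^sup>2"
      by (simp add: power_mono)
    also have "\<dots> = (1 - t) * (mdist X r p)\<^sup>2 + t * (mdist X r q)\<^sup>2 - t * (1 - t) * (mdist X p q)\<^sup>2"
      unfolding m'_def dist_affine_combination using tri
      by (simp add: dist_commute mdist_commute)
    finally show ?thesis .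
  qed
  then show ?thesis
    using m by blast
qed

locale geometric_CAT0_action =
  fixes G :: "('g, 'h) monoid_scheme" (structure) and X :: "'x metric" and \<phi> :: "'g \<Rightarrow> 'x \<Rightarrow> 'x"
  assumes CAT0: "CAT0 X" and geometric: "geometric_action G X \<phi>"

sublocale geometric_CAT0_action \<subseteq> Metric_space "mspace X" "mdist X"
  by simp

sublocale geometric_CAT0_action \<subseteq> group_action G "mspace X" \<phi>
  using geometric by (simp add: geometric_action_def isometric_action_def)

sublocale geometric_CAT0_action \<subseteq> group G
  using group_hom by (rule group_hom.axioms(1))

context geometric_CAT0_action
begin

abbreviation "M \<equiv> mspace X"
abbreviation "d \<equiv> mdist X"

lemma geodesic: "geodesic_space X"
  using CAT0 by (simp add: CAT0_def)

lemma act_in: "\<lbrakk>g \<in> carrier G; x \<in> M\<rbrakk> \<Longrightarrow> \<phi> g x \<in> M"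
  using element_image by blast

lemma act_isometric: "\<lbrakk>g \<in> carrier G; x \<in> M; y \<in> M\<rbrakk> \<Longrightarrow> d (\<phi> g x) (\<phi> g y) = d x y"
  using geometric by (simp add: geometric_action_def isometric_action_def isometry_between_def)

lemma act_mult: "\<lbrakk>g \<in> carrier G; h \<in> carrier G; x \<in> M\<rbrakk> \<Longrightarrow> \<phi> (g \<otimes> h) x = \<phi> g (\<phi> h x)"
  using composition_rule by blast

lemma act_one: "x \<in> M \<Longrightarrow> \<phi> \<one> x = x"
  using id_eq_one by (metis restrict_apply')

lemma act_inv:
  assumes "g \<in> carrier G" "x \<in> M"
  shows "\<phi> (inv g) (\<phi> g x) = x" "\<phi> g (\<phi> (inv g) x) = x"
  using assms act_mult[of "inv g" g x] act_mult[of g "inv g" x] act_one by auto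

section \<open>Finiteness and completeness from the geometric action\<close>

lemma ex_compact_domain:
  obtains K where "compactin mtopology K" "\<And>x. x \<in> M \<Longrightarrow> \<exists>g\<in>carrier G. \<exists>k\<in>K. x = \<phi> g k"
proof -
  obtain K where K: "compactin (mtopology_of X) K" "(\<Union>g\<in>carrier G. \<phi> g ` K) = M"
    using geometric by (auto simp: geometric_action_def cocompact_def)
  show thesis
  proof (rule that)
    show "compactin mtopology K"
      using K(1) by (simp add: mtopology_of_def)
    show "\<exists>g\<in>carrier G. \<exists>k\<in>K. x = \<phi> g k" if "x \<in> M" for x
      using that unfolding K(2)[symmetric] by blast
  qed
qed

lemma compactin_act:
  assumes "compactin mtopology K" "g \<in> carrier G"
  shows "compactin mtopology (\<phi> g ` K)"
proof -
  have "continuous_map mtopology mtopology (\<phi> g)"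
    unfolding metric_continuous_map[OF Metric_space_axioms]
  proof (intro conjI ballI allI impI)
    show "\<phi> g ` M \<subseteq> M"
      using act_in[OF assms(2)] by blast
    fix a and \<epsilon> :: real assume a: "a \<in> M" and "\<epsilon> > 0"
    then show "\<exists>\<delta>>0. \<forall>x. x \<in> M \<and> d a x < \<delta> \<longrightarrow> d (\<phi> g a) (\<phi> g x) < \<epsilon>"
      using act_isometric[OF assms(2) a] by (intro exI[of _ \<epsilon>]) simp
  qed
  then show ?thesis
    using assms(1) image_compactin by blast
qed

text \<open>Otherwise there are distinct \<open>g n\<close> and points \<open>x n\<close>,
  \<open>y n\<close> of \<open>K\<close> with \<open>x n\<close> ever closer to the image of
  \<open>y n\<close>. Along a subsequence they tend to \<open>a\<close> and \<open>b\<close>, and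
  infinitely many \<open>g n\<close> carry \<open>b\<close> close to \<open>a\<close>.\<close>

lemma finite_near_identity:
  assumes K: "compactin mtopology K"
  shows "\<exists>\<epsilon>>0. finite {g \<in> carrier G. \<exists>x\<in>K. \<exists>y\<in>K. d x (\<phi> g y) \<le> \<epsilon>}"
proof (rule ccontr)
  assume *: "\<not> ?thesis"
  define A where "A n = {g \<in> carrier G. \<exists>x\<in>K. \<exists>y\<in>K. d x (\<phi> g y) \<le> inverse (real (Suc n))}" for n
  have inf: "infinite (A n)" for n
  proof -
    have "inverse (real (Suc n)) > 0"
      by simp
    then show ?thesis
      using * unfolding A_def by blast
  qed
  have KM: "K \<subseteq> M"
    using compactin_subset_topspace[OF K] by simp
  have "\<exists>g. \<forall>n. g n \<in> A n \<and> g n \<notin> g ` {..<n}"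
  proof (rule dependent_wellorder_choice)
    show "\<exists>r. r \<in> A n \<and> r \<notin> f ` {..<n}" for n and f :: "nat \<Rightarrow> 'g"
      using infinite_super[of "A n" "f ` {..<n}"] inf[of n] by blast
  qed (auto simp: image_def)
  then obtain g where gA: "\<And>n. g n \<in> A n" and new: "\<And>n. g n \<notin> g ` {..<n}"
    by blast
  have g: "\<And>n. g n \<in> carrier G"
    using gA by (simp add: A_def)
  have inj: "inj g"
    using new by (metis imageI lessThan_iff linorder_injI)
  have "\<forall>n. \<exists>x y. x \<in> K \<and> y \<in> K \<and> d x (\<phi> (g n) y) \<le> inverse (real (Suc n))"
    using gA unfolding A_def by blast
  then obtain x y where xy: "\<And>n. x n \<in> K" "\<And>n. y n \<in> K" "\<And>n. d (x n) (\<phi> (g n) (y n)) \<le> inverse (real (Suc n))"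
    by metis
  obtain a r where a: "a \<in> K" "strict_mono r" "limitin mtopology (x \<circ> r) a sequentially"
    using K xy(1) unfolding compactin_sequentially by (meson image_subsetI)
  obtain b s where b: "b \<in> K" "strict_mono s" "limitin mtopology ((y \<circ> r) \<circ> s) b sequentially"
    using K xy(2) unfolding compactin_sequentially by (metis comp_apply image_subsetI)
  define t where "t = r \<circ> s"
  have t: "strict_mono t"
    using a b by (simp add: t_def strict_mono_o)
  have lim_x: "(\<lambda>n. d (x (t n)) a) \<longlonglongrightarrow> 0"
    using limitin_subsequence[OF b(2) a(3)] by (simp add: limitin_metric_dist_null t_def o_def)
  have lim_y: "(\<lambda>n. d (y (t n)) b) \<longlonglongrightarrow> 0"
    using b(3) by (simp add: limitin_metric_dist_null t_def o_def)
  have lim_i: "(\<lambda>n. inverse (real (Suc (t n)))) \<longlonglongrightarrow> 0"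
    using LIMSEQ_subseq_LIMSEQ[OF LIMSEQ_inverse_real_of_nat t] by (simp add: o_def)
  have M: "a \<in> M" "b \<in> M" "\<And>n. x n \<in> M" "\<And>n. y n \<in> M"
    using a b xy KM by auto
  obtain \<rho> where \<rho>: "\<rho> > 0" "finite {h \<in> carrier G. \<phi> h ` mball a \<rho> \<inter> mball a \<rho> \<noteq> {}}"
    using geometric M(1) by (auto simp: geometric_action_def properly_discontinuous_def mball_of_def)
  have bound: "d a (\<phi> (g (t n)) b) \<le> d (x (t n)) a + inverse (real (Suc (t n))) + d (y (t n)) b" for n
  proof -
    let ?g = "\<phi> (g (t n))"
    have gM: "?g b \<in> M" "?g (y (t n)) \<in> M"
      using act_in g M by auto
    have "d a (?g b) \<le> d a (x (t n)) + d (x (t n)) (?g b)"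
      using triangle M gM by blast
    moreover have "d (x (t n)) (?g b) \<le> d (x (t n)) (?g (y (t n))) + d (?g (y (t n))) (?g b)"
      using triangle M gM by blast
    ultimately show ?thesis
      using xy(3)[of "t n"] act_isometric[OF g M(4) M(2), of "t n"] by (simp add: commute)
  qed
  have "(\<lambda>n. d (x (t n)) a + inverse (real (Suc (t n))) + d (y (t n)) b) \<longlonglongrightarrow> 0 + 0 + 0"
    by (intro tendsto_add lim_x lim_y lim_i)
  then have "\<forall>\<^sub>F n in sequentially. d (x (t n)) a + inverse (real (Suc (t n))) + d (y (t n)) b < \<rho>"
    using \<rho>(1) by (simp add: order_tendsto_iff)
  then obtain N where "\<And>n. n \<ge> N \<Longrightarrow> d (x (t n)) a + inverse (real (Suc (t n))) + d (y (t n)) b < \<rho>"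
    by (auto simp: eventually_sequentially)
  then have close: "d a (\<phi> (g (t n)) b) < \<rho>" if "n \<ge> N" for n
    using bound[of n] that by fastforce
  \<comment> \<open>Dividing by one fixed \<open>g (t N)\<close> turns elements carrying
    \<open>b\<close> near \<open>a\<close> into elements carrying a point near \<open>a\<close> to
    points near \<open>a\<close>, as proper discontinuity at \<open>a\<close> requires.\<close>
  define h where "h n = g (t n) \<otimes> inv (g (t N))" for n
  have "h ` {N..} \<subseteq> {h \<in> carrier G. \<phi> h ` mball a \<rho> \<inter> mball a \<rho> \<noteq> {}}"
  proof (intro image_subsetI CollectI conjI)
    fix n assume n: "n \<in> {N..}"
    show "h n \<in> carrier G"
      using g by (simp add: h_def)
    have "\<phi> (h n) (\<phi> (g (t N)) b) = \<phi> (g (t n)) b"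
      using g M act_mult act_in act_inv by (simp add: h_def)
    moreover have "\<phi> (g (t N)) b \<in> mball a \<rho>" "\<phi> (g (t n)) b \<in> mball a \<rho>"
      using close n M act_in g by auto
    ultimately show "\<phi> (h n) ` mball a \<rho> \<inter> mball a \<rho> \<noteq> {}"
      by (metis IntI empty_iff imageI)
  qed
  then have "finite (h ` {N..})"
    using \<rho>(2) finite_subset by blast
  moreover have "inj_on h {N..}"
  proof (rule inj_onI)
    fix i j assume "h i = h j"
    then have "g (t i) = g (t j)"
      using g by (simp add: h_def)
    then show "i = j"
      using inj t by (simp add: inj_eq strict_mono_eq)
  qed
  ultimately have "finite {N..}"
    using finite_imageD by blast
  then show False
    using infinite_Ici by blast
qed

text \<open>Cut a geodesic at distance at most \<open>r\<close> from its start and move the cut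
  point into \<open>K\<close>: an element of \<open>F (r + \<epsilon>)\<close> becomes a product
  from \<open>F r\<close> and \<open>F \<epsilon>\<close>. Induction reaches any radius.\<close>

lemma finite_near:
  assumes K: "compactin mtopology K" and cover: "\<And>x. x \<in> M \<Longrightarrow> \<exists>g\<in>carrier G. \<exists>k\<in>K. x = \<phi> g k"
  shows "finite {g \<in> carrier G. \<exists>x\<in>K. \<exists>y\<in>K. d x (\<phi> g y) \<le> R}"
proof -
  define F where "F r = {g \<in> carrier G. \<exists>x\<in>K. \<exists>y\<in>K. d x (\<phi> g y) \<le> r}" for r
  obtain \<epsilon> where \<epsilon>: "\<epsilon> > 0" "finite (F \<epsilon>)"
    using finite_near_identity[OF K] by (auto simp: F_def)
  have KM: "K \<subseteq> M"
    using compactin_subset_topspace[OF K] by simp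
  have step: "F (r + \<epsilon>) \<subseteq> (\<lambda>(g, h). g \<otimes> h) ` (F r \<times> F \<epsilon>)" if r: "r \<ge> 0" for r
  proof
    fix g assume "g \<in> F (r + \<epsilon>)"
    then obtain x y where g: "g \<in> carrier G" and xy: "x \<in> K" "y \<in> K" "d x (\<phi> g y) \<le> r + \<epsilon>"
      by (auto simp: F_def)
    have M: "x \<in> M" "y \<in> M" "\<phi> g y \<in> M"
      using xy g act_in KM by auto
    obtain c where c: "\<And>s. \<lbrakk>0 \<le> s; s \<le> d x (\<phi> g y)\<rbrakk> \<Longrightarrow>
      c s \<in> M \<and> d x (c s) = s \<and> d (c s) (\<phi> g y) = d x (\<phi> g y) - s"
      using geodesic_pointE[OF geodesic M(1,3)] by metis
    define m where "m = c (min r (d x (\<phi> g y)))"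
    have m: "m \<in> M" "d x m \<le> r" "d m (\<phi> g y) \<le> \<epsilon>"
      using c[of "min r (d x (\<phi> g y))"] r xy(3) \<epsilon>(1) unfolding m_def by (auto simp: min_def)
    obtain g' k where g': "g' \<in> carrier G" "k \<in> K" "m = \<phi> g' k"
      using cover m(1) by blast
    define h where "h = inv g' \<otimes> g"
    have h: "h \<in> carrier G" "g = g' \<otimes> h"
      using g g' by (simp_all add: h_def m_assoc[symmetric])
    have "g' \<in> F r"
      using g' m(2) xy by (auto simp: F_def)
    moreover have "d m (\<phi> g y) = d k (\<phi> h y)"
      using act_isometric[OF g'(1)] act_mult[OF g'(1) h(1) M(2)] act_in[OF h(1) M(2)] g' h KM by auto
    then have "h \<in> F \<epsilon>"
      using h m(3) g' xy by (auto simp: F_def)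
    ultimately show "g \<in> (\<lambda>(g, h). g \<otimes> h) ` (F r \<times> F \<epsilon>)"
      using h(2) by force
  qed
  have "finite (F (\<epsilon> + real n * \<epsilon>))" for n
  proof (induction n)
    case 0
    then show ?case
      using \<epsilon> by simp
  next
    case (Suc n)
    have "F (\<epsilon> + real (Suc n) * \<epsilon>) = F ((\<epsilon> + real n * \<epsilon>) + \<epsilon>)"
      by (simp add: algebra_simps)
    then show ?case
      using step[of "\<epsilon> + real n * \<epsilon>"] Suc \<epsilon> by (metis add_nonneg_nonneg finite_SigmaI
          finite_imageI finite_subset less_imp_le mult_nonneg_nonneg of_nat_0_le_iff)
  qed
  moreover obtain n where "R < real n * \<epsilon>"
    using reals_Archimedean3[OF \<epsilon>(1)] by auto
  then have "R \<le> \<epsilon> + real n * \<epsilon>"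
    using \<epsilon>(1) by simp
  then have "F R \<subseteq> F (\<epsilon> + real n * \<epsilon>)"
    unfolding F_def using order_trans by blast
  ultimately show ?thesis
    unfolding F_def by (meson finite_subset)
qed

text \<open>By \<open>finite_near\<close>, the tail of a Cauchy sequence lies in finitely many
  translates of a compact set, hence in a compact set.\<close>

lemma mcomplete: mcomplete
  unfolding mcomplete_def
proof (intro allI impI)
  fix \<sigma> assume \<sigma>: "MCauchy \<sigma>"
  obtain K where K: "compactin mtopology K" and cover: "\<And>x. x \<in> M \<Longrightarrow> \<exists>g\<in>carrier G. \<exists>k\<in>K. x = \<phi> g k"
    using ex_compact_domain by blast
  have KM: "K \<subseteq> M"
    using compactin_subset_topspace[OF K] by simp
  have \<sigma>M: "\<And>n. \<sigma> n \<in> M"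
    using \<sigma> by (auto simp: MCauchy_def)
  obtain N where N: "\<And>n. n \<ge> N \<Longrightarrow> d (\<sigma> N) (\<sigma> n) < 1"
    using \<sigma> unfolding MCauchy_def by (meson order_refl zero_less_one)
  obtain g k where gk: "g \<in> carrier G" "k \<in> K" "\<sigma> N = \<phi> g k"
    using cover \<sigma>M by blast
  define F where "F = {g \<in> carrier G. \<exists>x\<in>K. \<exists>y\<in>K. d x (\<phi> g y) \<le> 1}"
  define U where "U = (\<Union>f\<in>F. \<phi> (g \<otimes> f) ` K)"
  have "finite F"
    unfolding F_def using finite_near[OF K cover] by blast
  then have U: "compactin mtopology U"
    unfolding U_def using gk K by (intro compactin_Union) (auto simp: F_def intro!: compactin_act)
  have in_U: "\<sigma> n \<in> U" if n: "n \<ge> N" for n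
  proof -
    obtain h l where hl: "h \<in> carrier G" "l \<in> K" "\<sigma> n = \<phi> h l"
      using cover \<sigma>M by blast
    define f where "f = inv g \<otimes> h"
    have f: "f \<in> carrier G" "h = g \<otimes> f"
      using gk hl by (simp_all add: f_def m_assoc[symmetric])
    have lM: "l \<in> M" "k \<in> M"
      using hl gk KM by auto
    have "d (\<sigma> N) (\<sigma> n) = d k (\<phi> f l)"
      using act_isometric[OF gk(1) lM(2) act_in[OF f(1) lM(1)]] act_mult[OF gk(1) f(1) lM(1)] gk hl f by simp
    then have "f \<in> F"
      using N[OF n] f gk hl by (force simp: F_def)
    then show ?thesis
      unfolding U_def using hl f by blast
  qed
  have "range (\<lambda>n. \<sigma> (N + n)) \<subseteq> U"
    using in_U by auto
  then obtain l r where "strict_mono r" "limitin mtopology ((\<lambda>n. \<sigma> (N + n)) \<circ> r) l sequentially"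
    using U unfolding compactin_sequentially by blast
  then have "limitin mtopology (\<sigma> \<circ> (\<lambda>n. N + r n)) l sequentially" "strict_mono (\<lambda>n. N + r n)"
    by (simp_all add: o_def strict_mono_def)
  then show "\<exists>x. limitin mtopology \<sigma> x sequentially"
    using MCauchy_convergent_subsequence[OF \<sigma>] by blast
qed

end

sublocale geometric_CAT0_action \<subseteq> hadamard_space "mspace X" "mdist X"
  by unfold_locales (use mcomplete CAT0_geodesic_point[OF CAT0] in auto)

section \<open>Central elements act trivially on a minimal set\<close>

lemma (in hadamard_space) quasi_inner_shift:
  assumes e: "\<And>x. x \<in> M \<Longrightarrow> e x \<in> M" "\<And>x y. \<lbrakk>x \<in> M; y \<in> M\<rbrakk> \<Longrightarrow> d (e x) (e y) = d x y"
    and g: "\<And>x. x \<in> M \<Longrightarrow> g x \<in> M" "\<And>x y. \<lbrakk>x \<in> M; y \<in> M\<rbrakk> \<Longrightarrow> d (g x) (g y) = d x y"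
    and comm: "\<And>x. x \<in> M \<Longrightarrow> g (e x) = e (g x)"
    and p: "p \<in> M" and q: "q \<in> M"
  shows "\<bar>quasi_inner (g p) (g q) p ((e ^^ n) p) - quasi_inner p q p ((e ^^ n) p)\<bar>
    \<le> 2 * ((d p q)\<^sup>2 + (d p (g p))\<^sup>2)"
proof -
  have en: "(e ^^ n) x \<in> M" if "x \<in> M" for n x
    using that e(1) by (induction n) auto
  have en_isom: "d ((e ^^ n) x) ((e ^^ n) y) = d x y" if "x \<in> M" "y \<in> M" for n x y
    using that by (induction n) (simp_all add: e(2) en)
  have en_comm: "(e ^^ n) (g x) = g ((e ^^ n) x)" if "x \<in> M" for n x
    using that by (induction n) (simp_all add: comm en)
  let ?z = "(e ^^ n) p" and ?z' = "(e ^^ n) (g p)"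
  have M: "g p \<in> M" "g q \<in> M" "?z \<in> M" "?z' \<in> M"
    using g en p q by auto
  \<comment> \<open>Applying \<open>g\<close> to all four points changes nothing; moving the
    right-hand pair back to \<open>p\<close> and \<open>?z\<close> costs two terms. Since
    \<open>e\<close> is an isometry commuting with \<open>g\<close>, their bound is independent of
    \<open>n\<close>.\<close>
  have "quasi_inner (g p) (g q) (g p) ?z' = quasi_inner p q p ?z"
    using en_comm[OF p] g(2) p q M(3) by (simp add: quasi_inner_def)
  then have "\<bar>quasi_inner (g p) (g q) p ?z - quasi_inner p q p ?z\<bar>
    = \<bar>quasi_inner (g p) (g q) p (g p) + quasi_inner (g p) (g q) ?z' ?z\<bar>"
    by (simp add: quasi_inner_def)
  also have "\<dots> \<le> \<bar>quasi_inner (g p) (g q) p (g p)\<bar> + \<bar>quasi_inner (g p) (g q) ?z' ?z\<bar>"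
    by (rule abs_triangle_ineq)
  also have "\<dots> \<le> ((d p q)\<^sup>2 + (d p (g p))\<^sup>2) + ((d p q)\<^sup>2 + (d p (g p))\<^sup>2)"
  proof (rule add_mono)
    show "\<bar>quasi_inner (g p) (g q) p (g p)\<bar> \<le> (d p q)\<^sup>2 + (d p (g p))\<^sup>2"
      using quasi_inner_bound[OF M(1,2) p M(1)] g(2)[OF p q] by simp
    show "\<bar>quasi_inner (g p) (g q) ?z' ?z\<bar> \<le> (d p q)\<^sup>2 + (d p (g p))\<^sup>2"
      using quasi_inner_bound[OF M(1,2,4,3)] g(2)[OF p q] en_isom[OF M(1) p, of n]
      by (simp add: commute)
  qed
  finally show ?thesis
    by simp
qed

context geometric_CAT0_action
begin

lemma subgroup_isometries:
  assumes "subgroup H G"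
  shows "hadamard_isometries M d (\<phi> ` H)"
proof
  note H = subgroup.mem_carrier[OF assms]
  show "\<gamma> x \<in> M" if "\<gamma> \<in> \<phi> ` H" "x \<in> M" for \<gamma> x
    using that H act_in by blast
  show "d (\<gamma> x) (\<gamma> y) = d x y" if "\<gamma> \<in> \<phi> ` H" "x \<in> M" "y \<in> M" for \<gamma> x y
    using that H act_isometric by blast
  show "\<exists>\<gamma>'\<in>\<phi> ` H. \<forall>x\<in>M. \<gamma> (\<gamma>' x) = x" if \<gamma>: "\<gamma> \<in> \<phi> ` H" for \<gamma>
  proof -
    obtain h where "h \<in> H" "\<gamma> = \<phi> h"
      using \<gamma> by blast
    then show ?thesis
      using act_inv(2) H subgroup.m_inv_closed[OF assms]
      by (intro bexI[of _ "\<phi> (inv h)"]) auto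
  qed
qed

lemma act_commute:
  assumes "g \<in> carrier G" "h \<in> carrier G" "x \<in> M" "g \<otimes> h = h \<otimes> g"
  shows "\<phi> g (\<phi> h x) = \<phi> h (\<phi> g x)"
  using assms act_mult by metis

lemma inv_involution:
  assumes "s \<in> carrier G" "s \<otimes> s = \<one>"
  shows "inv s = s"
  using assms inv_equality by blast

text \<open>Modulo bounded errors, \<open>g \<mapsto> quasi_inner p (\<phi> g p) p (\<phi> z ^^ n) p\<close> is a homomorphism
  into the reals, and it vanishes on involutions.\<close>

lemma quasi_inner_bounded:
  assumes z: "z \<in> carrier G" "\<And>g. g \<in> carrier G \<Longrightarrow> g \<otimes> z = z \<otimes> g"
    and S: "S \<subseteq> carrier G" "\<And>s. s \<in> S \<Longrightarrow> s \<otimes> s = \<one>"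
    and p: "p \<in> M" and g: "g \<in> generate G S"
  shows "\<exists>B. \<forall>n. \<bar>quasi_inner p (\<phi> g p) p ((\<phi> z ^^ n) p)\<bar> \<le> B"
proof -
  have shift: "\<bar>quasi_inner (\<phi> g p) (\<phi> g q) p ((\<phi> z ^^ n) p) - quasi_inner p q p ((\<phi> z ^^ n) p)\<bar>
    \<le> 2 * ((d p q)\<^sup>2 + (d p (\<phi> g p))\<^sup>2)" if "g \<in> carrier G" "q \<in> M" for g q n
    using that z p act_in act_isometric act_commute by (intro quasi_inner_shift) auto
  have involution: "\<exists>B. \<forall>n. \<bar>quasi_inner p (\<phi> s p) p ((\<phi> z ^^ n) p)\<bar> \<le> B" if s: "s \<in> S" for s
  proof (intro exI allI)
    fix n
    have sG: "s \<in> carrier G"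
      using s S by blast
    have "\<phi> s (\<phi> s p) = p"
      using act_mult[OF sG sG p] S(2)[OF s] act_one p by simp
    \<comment> \<open>The involution reverses the step from \<open>p\<close> to its image, so the
      value agrees with its own negative up to a bounded error.\<close>
    then have "quasi_inner (\<phi> s p) (\<phi> s (\<phi> s p)) p ((\<phi> z ^^ n) p) = - quasi_inner p (\<phi> s p) p ((\<phi> z ^^ n) p)"
      by (simp add: quasi_inner_def)
    then show "\<bar>quasi_inner p (\<phi> s p) p ((\<phi> z ^^ n) p)\<bar> \<le> 2 * ((d p (\<phi> s p))\<^sup>2 + (d p (\<phi> s p))\<^sup>2)"
      using shift[OF sG act_in[OF sG p], of n] by linarith
  qed
  show ?thesis
    using g
  proof (induction rule: generate.induct)
    case one
    then show ?case
      using act_one p by (auto simp: quasi_inner_def)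
  next
    case (incl s)
    then show ?case
      using involution by blast
  next
    case (inv s)
    then show ?case
      using involution inv_involution S by (metis subsetD)
  next
    case (eng g h)
    then obtain B C where B: "\<And>n. \<bar>quasi_inner p (\<phi> g p) p ((\<phi> z ^^ n) p)\<bar> \<le> B"
      and C: "\<And>n. \<bar>quasi_inner p (\<phi> h p) p ((\<phi> z ^^ n) p)\<bar> \<le> C"
      by blast
    have gh: "g \<in> carrier G" "h \<in> carrier G"
      using eng generate_in_carrier S(1) by blast+
    show ?case
    proof (intro exI allI)
      fix n
      have "quasi_inner p (\<phi> (g \<otimes> h) p) p ((\<phi> z ^^ n) p)
        = quasi_inner p (\<phi> g p) p ((\<phi> z ^^ n) p) + quasi_inner (\<phi> g p) (\<phi> g (\<phi> h p)) p ((\<phi> z ^^ n) p)"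
        using act_mult[OF gh p] quasi_inner_add_left by simp
      then show "\<bar>quasi_inner p (\<phi> (g \<otimes> h) p) p ((\<phi> z ^^ n) p)\<bar>
        \<le> B + (C + 2 * ((d p (\<phi> h p))\<^sup>2 + (d p (\<phi> g p))\<^sup>2))"
        using B[of n] C[of n] shift[OF gh(1) act_in[OF gh(2) p], of n] by linarith
    qed
  qed
qed

text \<open>\<open>quasi_inner_bounded\<close> is applied to \<open>z\<close> itself. Since
  \<open>z\<close> shifts its own orbit, the bounded quantity dominates the increment from the
  \<open>n\<close>-th to the next squared displacement, which gives the linear bound for
  \<open>clifford_trivial\<close>.\<close>

lemma central_acts_trivially:
  assumes z: "z \<in> carrier G" "\<And>g. g \<in> carrier G \<Longrightarrow> g \<otimes> z = z \<otimes> g"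
    and S: "S \<subseteq> carrier G" "\<And>s. s \<in> S \<Longrightarrow> s \<otimes> s = \<one>" "generate G S = carrier G"
    and Y: "hadamard_isometries.minimal M d (\<phi> ` carrier G) Y" and x: "x \<in> Y"
  shows "\<phi> z x = x"
proof -
  interpret hadamard_isometries M d "\<phi> ` carrier G"
    using subgroup_isometries[OF subgroup_self] .
  have YM: "\<And>y. y \<in> Y \<Longrightarrow> y \<in> M"
    using minimal_subset[OF Y] by blast
  note xM = YM[OF x]
  have zn: "(\<phi> z ^^ n) x \<in> M" for n
    using xM act_in[OF z(1)] by (induction n) auto
  obtain B where B: "\<And>n. \<bar>quasi_inner x (\<phi> z x) x ((\<phi> z ^^ n) x)\<bar> \<le> B"
    using quasi_inner_bounded[OF z S(1,2) xM] z(1) S(3) by blast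
  have bound: "(d x ((\<phi> z ^^ n) x))\<^sup>2 \<le> real n * B" for n
  proof (induction n)
    case 0
    then show ?case
      using xM by simp
  next
    case (Suc n)
    have "d (\<phi> z x) ((\<phi> z ^^ Suc n) x) = d x ((\<phi> z ^^ n) x)"
      using act_isometric[OF z(1) xM zn] by simp
    then have "(d x ((\<phi> z ^^ Suc n) x))\<^sup>2 \<le> (d x ((\<phi> z ^^ n) x))\<^sup>2 + B"
      using B[of "Suc n"] xM by (simp add: quasi_inner_def abs_le_iff)
        (smt (verit) zero_le_power2)
    then show ?case
      using Suc by (simp add: algebra_simps)
  qed
  show ?thesis
  proof (rule clifford_trivial[OF Y, of "\<phi> z", OF _ _ _ x bound x])
    show "\<phi> z y \<in> Y" if "y \<in> Y" for y
      using minimal_invariant[OF Y] that z(1) by blast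
    show "d (\<phi> z y) (\<phi> z w) = d y w" if "y \<in> Y" "w \<in> Y" for y w
      using act_isometric[OF z(1)] YM that by blast
    show "\<phi> z (\<gamma> y) = \<gamma> (\<phi> z y)" if "\<gamma> \<in> \<phi> ` carrier G" "y \<in> Y" for \<gamma> y
      using that act_commute[OF z(1)] z(2) YM by (metis imageE)
  qed
qed

lemma ex_minimal_whole:
  obtains Y where "hadamard_isometries.minimal M d (\<phi> ` carrier G) Y"
proof -
  interpret hadamard_isometries M d "\<phi> ` carrier G"
    using subgroup_isometries[OF subgroup_self] .
  obtain K where K: "compactin mtopology K" and cover: "\<And>x. x \<in> M \<Longrightarrow> \<exists>g\<in>carrier G. \<exists>k\<in>K. x = \<phi> g k"
    using ex_compact_domain by blast
  have KM: "K \<subseteq> M"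
    using compactin_subset_topspace[OF K] by simp
  have "closed_convex M"
    using gp_in by (intro closed_convexI) (auto simp: limitin_metric_dist_null)
  moreover have "invariant M"
    using maps by (auto simp: invariant_def)
  moreover have "M \<noteq> {}"
    using geometric by (simp add: geometric_action_def)
  moreover have "\<exists>\<gamma>\<in>\<phi> ` carrier G. \<gamma> x \<in> K" if x: "x \<in> M" for x
  proof -
    obtain g k where gk: "g \<in> carrier G" "k \<in> K" "x = \<phi> g k"
      using cover x by blast
    then have "\<phi> (inv g) x = k"
      using act_inv(1) KM by blast
    then show ?thesis
      using gk by (metis imageI inv_closed)
  qed
  ultimately show thesis
    using ex_minimal[OF _ _ _ K] that by metis
qed

section \<open>A minimal set for one factor\<close>

lemma commute_generate:
  assumes z: "z \<in> carrier G" and T: "T \<subseteq> carrier G" "\<And>t. t \<in> T \<Longrightarrow> t \<otimes> z = z \<otimes> t"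
    and g: "g \<in> generate G T"
  shows "g \<otimes> z = z \<otimes> g"
  using g
proof (induction rule: generate.induct)
  case (inv t)
  then have t: "t \<in> carrier G" "t \<otimes> z = z \<otimes> t"
    using T by auto
  have "inv t \<otimes> z = inv t \<otimes> (z \<otimes> t) \<otimes> inv t"
    using t(1) z by (simp add: m_assoc)
  also have "\<dots> = inv t \<otimes> (t \<otimes> z) \<otimes> inv t"
    using t(2) by simp
  also have "\<dots> = z \<otimes> inv t"
    using t(1) z by (simp add: m_assoc[symmetric])
  finally show ?case .
next
  case (eng g h)
  then have "g \<in> carrier G" "h \<in> carrier G"
    using generate_in_carrier T(1) by blast+
  then show ?case
    using eng z by (metis m_assoc)
qed (use z T in auto)

text \<open>The set \<open>Y0\<close> of points of \<open>Y\<close> moved by at most \<open>R\<close> by the elements of \<open>T\<close> is invariant under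
  \<open>H\<close>, and \<open>H\<close> acts on it cocompactly: up to finitely many choices, these displacements determine
  the \<open>generate G T\<close>-component of a point modulo the centre, which acts trivially on \<open>Y\<close>.\<close>

lemma ex_minimal_factor:
  assumes H: "subgroup H G" and T: "T \<subseteq> carrier G" "finite T"
    and comm: "\<And>h k. \<lbrakk>h \<in> H; k \<in> generate G T\<rbrakk> \<Longrightarrow> h \<otimes> k = k \<otimes> h"
    and prod: "\<And>g. g \<in> carrier G \<Longrightarrow> \<exists>h\<in>H. \<exists>k\<in>generate G T. g = h \<otimes> k"
    and S: "S \<subseteq> carrier G" "\<And>s. s \<in> S \<Longrightarrow> s \<otimes> s = \<one>" "generate G S = carrier G"
  obtains C where "hadamard_isometries.minimal M d (\<phi> ` H) C"
proof -
  interpret H: hadamard_isometries M d "\<phi> ` H"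
    using subgroup_isometries[OF H] .
  interpret G: hadamard_isometries M d "\<phi> ` carrier G"
    using subgroup_isometries[OF subgroup_self] .
  note HG = subgroup.mem_carrier[OF H]
  have KG: "\<And>k. k \<in> generate G T \<Longrightarrow> k \<in> carrier G"
    using generate_in_carrier[OF T(1)] by blast
  obtain Y where Y: "G.minimal Y"
    using ex_minimal_whole by blast
  note YM = subsetD[OF G.minimal_subset[OF Y]]
  have act_Y: "\<phi> g y \<in> Y" if "g \<in> carrier G" "y \<in> Y" for g y
    using G.minimal_invariant[OF Y] that by blast
  obtain x0 where x0: "x0 \<in> Y"
    using G.minimal_nonempty[OF Y] by blast
  define R where "R = (\<Sum>s\<in>T. d x0 (\<phi> s x0))"
  have R: "d x0 (\<phi> s x0) \<le> R" if "s \<in> T" for s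
    unfolding R_def using that T(2) by (intro member_le_sum) auto
  define Y0 where "Y0 = {y \<in> Y. \<forall>s\<in>T. d y (\<phi> s y) \<le> R}"
  have "closed_convex Y0"
  proof (rule closed_convexI)
    note YC = closed_convexD[OF G.minimal_closed_convex[OF Y]]
    show "Y0 \<subseteq> M"
      using YM by (auto simp: Y0_def)
    show "l \<in> Y0" if \<sigma>: "\<And>n. \<sigma> n \<in> Y0" "limitin mtopology \<sigma> l sequentially" for \<sigma> l
    proof -
      have l: "l \<in> Y" "l \<in> M" and \<sigma>M: "\<sigma> n \<in> M" for n
        using YC(2)[of \<sigma> l] \<sigma> YM by (auto simp: Y0_def)
      have "d l (\<phi> s l) \<le> R" if s: "s \<in> T" for s
      proof -
        have sG: "s \<in> carrier G"
          using s T by blast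
        have "limitin mtopology (\<lambda>n. \<phi> s (\<sigma> n)) (\<phi> s l) sequentially"
          using \<sigma>(2) l \<sigma>M act_in[OF sG] act_isometric[OF sG] by (simp add: limitin_metric_dist_null)
        then have "(\<lambda>n. d (\<sigma> n) (\<phi> s (\<sigma> n))) \<longlonglongrightarrow> d l (\<phi> s l)"
          using \<sigma>(2) \<sigma>M act_in[OF sG] by (intro tendsto_dist) auto
        moreover have "d (\<sigma> n) (\<phi> s (\<sigma> n)) \<le> R" for n
          using \<sigma>(1)[of n] s by (simp add: Y0_def)
        ultimately show ?thesis
          using LIMSEQ_le_const2 by blast
      qed
      then show ?thesis
        using l by (simp add: Y0_def)
    qed
    show "gp p q t \<in> Y0" if pq: "p \<in> Y0" "q \<in> Y0" and t: "0 \<le> t" "t \<le> 1" for p q t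
    proof -
      have Y: "p \<in> Y" "q \<in> Y" "p \<in> M" "q \<in> M"
        using pq YM by (auto simp: Y0_def)
      have "d (gp p q t) (\<phi> s (gp p q t)) \<le> R" if s: "s \<in> T" for s
      proof -
        have sG: "s \<in> carrier G"
          using s T by blast
        have "\<phi> s (gp p q t) = gp (\<phi> s p) (\<phi> s q) t"
          using G.isometry_gp Y t sG by blast
        then have "d (gp p q t) (\<phi> s (gp p q t)) \<le> (1 - t) * d p (\<phi> s p) + t * d q (\<phi> s q)"
          using dist_gp_gp Y t act_in[OF sG] by simp
        also have "\<dots> \<le> max (d p (\<phi> s p)) (d q (\<phi> s q))"
          using convex_combination_le_max[OF t] .
        also have "\<dots> \<le> R"
          using pq s by (simp add: Y0_def)
        finally show ?thesis .
      qed
      then show ?thesis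
        using YC(3) Y t by (simp add: Y0_def)
    qed
  qed
  moreover have "H.invariant Y0"
    unfolding H.invariant_def
  proof (intro ballI)
    fix \<gamma> y assume "\<gamma> \<in> \<phi> ` H" and y: "y \<in> Y0"
    then obtain h where h: "h \<in> H" "\<gamma> = \<phi> h"
      by blast
    have yY: "y \<in> Y" "y \<in> M"
      using y YM by (auto simp: Y0_def)
    have "d (\<phi> h y) (\<phi> s (\<phi> h y)) = d y (\<phi> s y)" if s: "s \<in> T" for s
    proof -
      have "s \<in> carrier G" "h \<otimes> s = s \<otimes> h"
        using s T comm[OF h(1) generate.incl] by auto
      then show ?thesis
        using act_commute[of h s y, symmetric] act_isometric[OF HG[OF h(1)] yY(2) act_in] HG[OF h(1)] yY
        by simp
    qed
    then show "\<gamma> y \<in> Y0"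
      using y h act_Y[OF HG[OF h(1)] yY(1)] by (simp add: Y0_def)
  qed
  moreover have "Y0 \<noteq> {}"
    using x0 R by (auto simp: Y0_def)
  moreover obtain Q where Q: "compactin mtopology Q"
    and cover: "\<And>x. x \<in> M \<Longrightarrow> \<exists>g\<in>carrier G. \<exists>q\<in>Q. x = \<phi> g q"
    using ex_compact_domain by blast
  have QM: "\<And>q. q \<in> Q \<Longrightarrow> q \<in> M"
    using compactin_subset_topspace[OF Q] by auto
  define F where "F = {g \<in> carrier G. \<exists>x\<in>Q. \<exists>y\<in>Q. d x (\<phi> g y) \<le> R}"
  \<comment> \<open>Conjugates of \<open>T\<close> in \<open>F\<close> leave finitely many tuples
    \<open>conj k\<close>, and \<open>k\<close>, \<open>b\<close> with the same tuple differ by an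
    element centralising \<open>T\<close>. The set \<open>B\<close> below holds representatives of
    the tuples.\<close>
  define conj where "conj k = (\<lambda>s\<in>T. inv k \<otimes> s \<otimes> k)" for k
  define A where "A = {k \<in> generate G T. \<forall>s\<in>T. inv k \<otimes> s \<otimes> k \<in> F}"
  have "finite F"
    unfolding F_def using finite_near[OF Q cover] .
  then have "finite (conj ` A)"
    using T(2) by (intro finite_subset[OF _ finite_PiE[of T "\<lambda>_. F"]]) (auto simp: conj_def A_def)
  then obtain B where B: "B \<subseteq> A" "finite B" "conj ` A = conj ` B"
    using finite_subset_image[of "conj ` A" conj A] by blast
  have BG: "\<And>b. b \<in> B \<Longrightarrow> b \<in> generate G T \<and> b \<in> carrier G"
    using B(1) KG by (auto simp: A_def)
  define Q' where "Q' = (\<Union>b\<in>B. \<phi> b ` Q)"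
  have Q': "compactin mtopology Q'"
    unfolding Q'_def using B(2) BG Q by (intro compactin_Union) (auto intro!: compactin_act)
  moreover have "\<exists>\<gamma>\<in>\<phi> ` H. \<gamma> x \<in> Q'" if x: "x \<in> Y0" for x
  proof -
    have xY: "x \<in> Y" "x \<in> M"
      using x YM by (auto simp: Y0_def)
    obtain g q where gq: "g \<in> carrier G" "q \<in> Q" "x = \<phi> g q"
      using cover xY by blast
    obtain h k where hk: "h \<in> H" "k \<in> generate G T" "g = h \<otimes> k"
      using prod gq(1) by blast
    note [simp] = HG[OF hk(1)] KG[OF hk(2)] QM[OF gq(2)] act_in
    have x_eq: "x = \<phi> h (\<phi> k q)"
      using gq hk act_mult by simp
    have qY: "q \<in> Y"
      using act_Y[OF inv_closed[OF gq(1)] xY(1)] act_inv(1)[OF gq(1) QM[OF gq(2)]] gq(3) by simp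
    \<comment> \<open>The displacement of \<open>x\<close> by \<open>s\<close> equals the
      displacement of \<open>q\<close> by the conjugate: \<open>h\<close> drops out by commutation
      and \<open>k\<close> is undone. As \<open>q\<close> lies in \<open>Q\<close>, membership in
      \<open>F\<close> follows.\<close>
    have "inv k \<otimes> s \<otimes> k \<in> F" if s: "s \<in> T" for s
    proof -
      have sG[simp]: "s \<in> carrier G" and "h \<otimes> s = s \<otimes> h"
        using s T comm[OF hk(1) generate.incl] by auto
      then have "\<phi> s x = \<phi> h (\<phi> s (\<phi> k q))"
        unfolding x_eq by (simp add: act_commute)
      then have "d x (\<phi> s x) = d (\<phi> k q) (\<phi> s (\<phi> k q))"
        unfolding x_eq by (simp add: act_isometric)
      also have "\<dots> = d (\<phi> (inv k) (\<phi> k q)) (\<phi> (inv k) (\<phi> s (\<phi> k q)))"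
        by (simp add: act_isometric)
      also have "\<dots> = d q (\<phi> (inv k \<otimes> s \<otimes> k) q)"
        by (simp add: act_inv act_mult)
      finally have "d x (\<phi> s x) = d q (\<phi> (inv k \<otimes> s \<otimes> k) q)" .
      moreover have "d x (\<phi> s x) \<le> R"
        using x s by (simp add: Y0_def)
      ultimately have "d q (\<phi> (inv k \<otimes> s \<otimes> k) q) \<le> R"
        by linarith
      then show ?thesis
        using gq(2) by (auto simp: F_def)
    qed
    then have "k \<in> A"
      using hk by (simp add: A_def)
    then have "conj k \<in> conj ` B"
      using B(3) by blast
    then obtain b where b: "b \<in> B" "conj k = conj b"
      by blast
    define z where "z = k \<otimes> inv b"
    note bG [simp] = conjunct2[OF BG[OF b(1)]]
    have z: "z \<in> generate G T" "z \<in> carrier G"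
      unfolding z_def using hk(2) BG[OF b(1)]
      by (auto intro!: generate.eng generate_m_inv_closed[OF T(1)])
    have "s \<otimes> z = z \<otimes> s" if s: "s \<in> T" for s
    proof -
      have sG[simp]: "s \<in> carrier G"
        using s T by blast
      have "inv k \<otimes> s \<otimes> k = inv b \<otimes> s \<otimes> b"
        using fun_cong[OF b(2), of s] s by (simp add: conj_def)
      then have "k \<otimes> (inv k \<otimes> s \<otimes> k) \<otimes> inv b = k \<otimes> (inv b \<otimes> s \<otimes> b) \<otimes> inv b"
        by simp
      moreover have "k \<otimes> (inv k \<otimes> s \<otimes> k) \<otimes> inv b = s \<otimes> z"
        unfolding z_def by (simp add: m_assoc[symmetric])
      moreover have "k \<otimes> (inv b \<otimes> s \<otimes> b) \<otimes> inv b = z \<otimes> s"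
        unfolding z_def by (simp add: m_assoc)
      ultimately show ?thesis
        by simp
    qed
    then have z_K: "k' \<otimes> z = z \<otimes> k'" if "k' \<in> generate G T" for k'
      using commute_generate[OF z(2) T(1)] that by blast
    \<comment> \<open>\<open>z\<close> lies in \<open>generate G T\<close>, so it commutes with
      \<open>H\<close> by assumption and with \<open>generate G T\<close> by \<open>z_K\<close>;
      hence it is central in \<open>G\<close>.\<close>
    have "g' \<otimes> z = z \<otimes> g'" if "g' \<in> carrier G" for g'
    proof -
      obtain h' k' where g': "h' \<in> H" "k' \<in> generate G T" "g' = h' \<otimes> k'"
        using prod \<open>g' \<in> carrier G\<close> by blast
      then have "h' \<otimes> k' \<otimes> z = h' \<otimes> z \<otimes> k'"
        using z_K z(2) HG KG by (simp add: m_assoc)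
      also have "\<dots> = z \<otimes> (h' \<otimes> k')"
        using comm[OF g'(1) z(1)] z(2) HG KG g' by (simp add: m_assoc)
      finally show ?thesis
        using g' by simp
    qed
    then have "\<phi> z (\<phi> b q) = \<phi> b q"
      using central_acts_trivially[OF z(2) _ S Y] act_Y[OF bG qY] by blast
    moreover have "k = z \<otimes> b"
      unfolding z_def by (simp add: m_assoc)
    ultimately have "\<phi> k q = \<phi> b q"
      using act_mult[OF z(2) bG QM[OF gq(2)]] by simp
    then have "\<phi> (inv h) x = \<phi> b q"
      unfolding x_eq by (simp add: act_inv)
    then show ?thesis
      using b gq(2) subgroup.m_inv_closed[OF H hk(1)] unfolding Q'_def by blast
  qed
  ultimately show thesis
    using H.ex_minimal[of Y0 Q'] that by metis
qed

end

text \<open>Elements of \<open>BijGroup\<close> are extensional functions, hence the restriction to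
  \<open>mspace E\<close> in the conclusion.\<close>

lemma isometric_actionI:
  fixes G :: "('g, 'h) monoid_scheme" and E :: "'x metric"
  assumes G: "group G"
    and closed: "\<And>g x. \<lbrakk>g \<in> carrier G; x \<in> mspace E\<rbrakk> \<Longrightarrow> \<psi> g x \<in> mspace E"
    and mult: "\<And>g h x. \<lbrakk>g \<in> carrier G; h \<in> carrier G; x \<in> mspace E\<rbrakk> \<Longrightarrow> \<psi> (g \<otimes>\<^bsub>G\<^esub> h) x = \<psi> g (\<psi> h x)"
    and one: "\<And>x. x \<in> mspace E \<Longrightarrow> \<psi> \<one>\<^bsub>G\<^esub> x = x"
    and isom: "\<And>g x y. \<lbrakk>g \<in> carrier G; x \<in> mspace E; y \<in> mspace E\<rbrakk> \<Longrightarrow>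
      mdist E (\<psi> g x) (\<psi> g y) = mdist E x y"
  shows "isometric_action G E (\<lambda>g. \<lambda>x\<in>mspace E. \<psi> g x)"
proof -
  interpret group G
    by (rule G)
  have bij: "bij_betw (\<psi> g) (mspace E) (mspace E)" if g: "g \<in> carrier G" for g
  proof (rule bij_betw_byWitness[where f' = "\<psi> (inv\<^bsub>G\<^esub> g)"])
    show "\<forall>a\<in>mspace E. \<psi> (inv\<^bsub>G\<^esub> g) (\<psi> g a) = a" "\<forall>a\<in>mspace E. \<psi> g (\<psi> (inv\<^bsub>G\<^esub> g) a) = a"
      using g one by (simp_all add: mult[symmetric])
  qed (use g closed in auto)
  have "group_hom G (BijGroup (mspace E)) (\<lambda>g. \<lambda>x\<in>mspace E. \<psi> g x)"
  proof (intro group_hom.intro group_hom_axioms.intro homI)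
    show "(\<lambda>x\<in>mspace E. \<psi> g x) \<in> carrier (BijGroup (mspace E))" if "g \<in> carrier G" for g
      using bij[OF that] by (simp add: BijGroup_def Bij_def bij_betw_restrict_eq)
    show "(\<lambda>x\<in>mspace E. \<psi> (g \<otimes>\<^bsub>G\<^esub> h) x)
      = (\<lambda>x\<in>mspace E. \<psi> g x) \<otimes>\<^bsub>BijGroup (mspace E)\<^esub> (\<lambda>x\<in>mspace E. \<psi> h x)"
      if "g \<in> carrier G" "h \<in> carrier G" for g h
      using bij[OF that(1)] bij[OF that(2)] that closed mult
      by (auto simp: BijGroup_def Bij_def compose_def bij_betw_restrict_eq fun_eq_iff)
  qed (use G group_BijGroup in auto)
  moreover have "isometry_between E E (\<lambda>x\<in>mspace E. \<psi> g x)" if "g \<in> carrier G" for g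
    using bij[OF that] isom[OF that] by (simp add: isometry_between_def bij_betw_restrict_eq)
  ultimately show ?thesis
    by (simp add: isometric_action_def group_action_def)
qed

lemma internal_direct_productD:
  assumes "group G" "internal_direct_product G H K"
  shows "subgroup H G" "subgroup K G" "\<And>g. g \<in> carrier G \<Longrightarrow> \<exists>h\<in>H. \<exists>k\<in>K. g = h \<otimes>\<^bsub>G\<^esub> k"
    "\<And>h k. \<lbrakk>h \<in> H; k \<in> K\<rbrakk> \<Longrightarrow> h \<otimes>\<^bsub>G\<^esub> k = k \<otimes>\<^bsub>G\<^esub> h"
proof -
  interpret group G
    by fact
  have H: "H \<lhd> G" and K: "K \<lhd> G" and int: "H \<inter> K = {\<one>\<^bsub>G\<^esub>}" and prod: "H <#>\<^bsub>G\<^esub> K = carrier G"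
    using assms(2) by (auto simp: internal_direct_product_def)
  show sH: "subgroup H G" and sK: "subgroup K G"
    using H K normal_imp_subgroup by auto
  show "\<exists>h\<in>H. \<exists>k\<in>K. g = h \<otimes>\<^bsub>G\<^esub> k" if "g \<in> carrier G" for g
    using that unfolding prod[symmetric] set_mult_def by blast
  show "h \<otimes>\<^bsub>G\<^esub> k = k \<otimes>\<^bsub>G\<^esub> h" if "h \<in> H" "k \<in> K" for h k
  proof -
    note [simp] = subgroup.mem_carrier[OF sH that(1)] subgroup.mem_carrier[OF sK that(2)]
    \<comment> \<open>The commutator of \<open>h\<close> and \<open>k\<close> lies in both normal
      subgroups, whose intersection is trivial.\<close>
    have "h \<otimes>\<^bsub>G\<^esub> k \<otimes>\<^bsub>G\<^esub> inv\<^bsub>G\<^esub> h \<in> K"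
      using normal.inv_op_closed2[OF K] that by simp
    then have 1: "h \<otimes>\<^bsub>G\<^esub> k \<otimes>\<^bsub>G\<^esub> inv\<^bsub>G\<^esub> h \<otimes>\<^bsub>G\<^esub> inv\<^bsub>G\<^esub> k \<in> K"
      using subgroup.m_closed[OF sK] subgroup.m_inv_closed[OF sK that(2)] by simp
    have "k \<otimes>\<^bsub>G\<^esub> inv\<^bsub>G\<^esub> h \<otimes>\<^bsub>G\<^esub> inv\<^bsub>G\<^esub> k \<in> H"
      using normal.inv_op_closed2[OF H] that subgroup.m_inv_closed[OF sH that(1)] by simp
    then have 2: "h \<otimes>\<^bsub>G\<^esub> (k \<otimes>\<^bsub>G\<^esub> inv\<^bsub>G\<^esub> h \<otimes>\<^bsub>G\<^esub> inv\<^bsub>G\<^esub> k) \<in> H"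
      using subgroup.m_closed[OF sH that(1)] by simp
    have "h \<otimes>\<^bsub>G\<^esub> k \<otimes>\<^bsub>G\<^esub> inv\<^bsub>G\<^esub> h \<otimes>\<^bsub>G\<^esub> inv\<^bsub>G\<^esub> k = \<one>\<^bsub>G\<^esub>"
      using 1 2 int by (auto simp: m_assoc)
    then have "(h \<otimes>\<^bsub>G\<^esub> k) \<otimes>\<^bsub>G\<^esub> inv\<^bsub>G\<^esub> (k \<otimes>\<^bsub>G\<^esub> h) = \<one>\<^bsub>G\<^esub>"
      by (simp add: inv_mult_group m_assoc)
    then show ?thesis
      by (metis \<open>h \<in> carrier G\<close> \<open>k \<in> carrier G\<close> inv_closed inv_equality inv_inv m_closed)
  qed
qed

text \<open>Because \<open>m s s\<close> is 1, the relator of the pair \<open>(s, s)\<close> is the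
  word \<open>s s\<close>, and the presentation evaluates it to the identity.\<close>

lemma coxeter_system_involutions:
  assumes "coxeter_system W S"
  shows "group W" "finite S" "S \<subseteq> carrier W" "generate W S = carrier W"
    "\<And>s. s \<in> S \<Longrightarrow> s \<otimes>\<^bsub>W\<^esub> s = \<one>\<^bsub>W\<^esub>"
proof -
  obtain m where m: "coxeter_matrix S m" and pres: "has_presentation W S (coxeter_relators S m)"
    using assms by (auto simp: coxeter_system_def)
  show "finite S"
    using assms by (simp add: coxeter_system_def)
  show G: "group W" and S: "S \<subseteq> carrier W" and "generate W S = carrier W"
    using pres by (auto simp: has_presentation_def)
  interpret group W
    by fact
  show "s \<otimes>\<^bsub>W\<^esub> s = \<one>\<^bsub>W\<^esub>" if s: "s \<in> S" for s
  proof -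
    let ?r = "[(s, True), (s, True)]"
    have "m s s = enat 1"
      using m s by (simp add: coxeter_matrix_def one_enat_def)
    then have "concat (replicate 1 ?r) \<in> coxeter_relators S m"
      using s unfolding coxeter_relators_def by blast
    then have r: "?r \<in> coxeter_relators S m"
      by simp
    have "word_eq S (coxeter_relators S m) ([] @ ?r @ []) ([] @ [])"
      using r by (intro word_eq.relator) (auto simp: words_def)
    moreover have "?r \<in> words S"
      using s by (simp add: words_def)
    moreover have "\<forall>w\<in>words S. word_eval W w = \<one>\<^bsub>W\<^esub> \<longleftrightarrow> word_eq S (coxeter_relators S m) w []"
      using pres unfolding has_presentation_def by blast
    ultimately have "word_eval W ?r = \<one>\<^bsub>W\<^esub>"
      unfolding append_Nil append_Nil2 by blast
    then show ?thesis
      using s S by (simp add: subset_iff)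
  qed
qed

section \<open>Assembling the product decomposition\<close>

context geometric_CAT0_action
begin

text \<open>By \<open>gp_unique\<close>, every point of an arbitrary geodesic segment is
  \<open>gp\<close> at its rescaled parameter.\<close>

lemma geodesically_convex_closed_convex:
  assumes C: "closed_convex C"
  shows "geodesically_convex X C"
  unfolding geodesically_convex_def
proof (intro conjI ballI allI impI subsetI)
  fix x assume "x \<in> C"
  then show "x \<in> M"
    using closed_convexD(1)[OF C] by blast
next
  fix p q \<sigma> x assume pq: "p \<in> C" "q \<in> C" and \<sigma>: "geodesic_segment X p q \<sigma>" and x: "x \<in> \<sigma>"
  obtain c l where c: "0 \<le> (l::real)" "c 0 = p" "c l = q" "\<sigma> = c ` {0..l}" "\<sigma> \<subseteq> M"
    "\<And>s t. \<lbrakk>s \<in> {0..l}; t \<in> {0..l}\<rbrakk> \<Longrightarrow> d (c s) (c t) = \<bar>s - t\<bar>"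
    using \<sigma> unfolding geodesic_segment_def by blast
  obtain s where s: "s \<in> {0..l}" "x = c s"
    using x c(4) by blast
  show "x \<in> C"
  proof (cases "l = 0")
    case True
    then show ?thesis
      using s c(2) pq by simp
  next
    case False
    then have l: "l > 0"
      using c(1) by simp
    have M: "p \<in> M" "q \<in> M" "x \<in> M"
      using pq closed_convexD(1)[OF C] x c(5) by auto
    have dists: "d p q = l" "d p x = s" "d x q = l - s"
      using c(6)[of 0 l] c(6)[of 0 s] c(6)[of s l] c(1-3) s by auto
    have "x = gp p q (s / l)"
    proof (rule gp_unique[OF M(1,2) _ _ M(3)])
      show "d p x = s / l * d p q" "d x q = (1 - s / l) * d p q"
        unfolding dists using l by (simp_all add: left_diff_distrib)
    qed (use s l in simp_all)
    then show ?thesis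
      using closed_convexD(3)[OF C pq, of "s / l"] l s by simp
  qed
qed

text \<open>A single orbit is quasi-dense: a compact set whose translates cover \<open>X\<close> is
  bounded.\<close>

lemma quasi_dense_invariant:
  assumes Z: "Z \<subseteq> M" "z \<in> Z" and inv: "\<And>g x. \<lbrakk>g \<in> carrier G; x \<in> Z\<rbrakk> \<Longrightarrow> \<phi> g x \<in> Z"
  shows "quasi_dense X Z"
proof -
  obtain Q where Q: "compactin mtopology Q"
    and cover: "\<And>x. x \<in> M \<Longrightarrow> \<exists>g\<in>carrier G. \<exists>q\<in>Q. x = \<phi> g q"
    using ex_compact_domain by blast
  have zM: "z \<in> M"
    using Z by blast
  obtain a r where ar: "Q \<subseteq> mcball a r"
    using compactin_imp_mbounded[OF Q] by (auto simp: mbounded_def)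
  define N where "N = \<bar>r\<bar> + d a z"
  have N: "d q z \<le> N" "q \<in> M" if "q \<in> Q" for q
  proof -
    have q: "a \<in> M" "q \<in> M" "d a q \<le> r"
      using ar that by auto
    then show "d q z \<le> N" "q \<in> M"
      using triangle[of q a z] zM by (auto simp: N_def commute)
  qed
  have "\<exists>y\<in>Z. d x y \<le> N" if x: "x \<in> M" for x
  proof -
    obtain g q where "g \<in> carrier G" "q \<in> Q" "x = \<phi> g q"
      using cover x by blast
    then show ?thesis
      using inv[of g z] Z(2) act_isometric[of g q z] N zM by metis
  qed
  moreover have "N \<ge> 0"
    by (simp add: N_def)
  ultimately show ?thesis
    using Z(1) by (auto simp: quasi_dense_def)
qed

theorem splitting:
  fixes H K T
  defines "K \<equiv> generate G T"
  assumes prod: "internal_direct_product G H K"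
    and S: "S \<subseteq> carrier G" "\<And>s. s \<in> S \<Longrightarrow> s \<otimes> s = \<one>" "generate G S = carrier G"
    and T: "T \<subseteq> carrier G" "finite T" "\<And>s. s \<in> T \<Longrightarrow> s \<otimes> s = \<one>"
  shows "\<exists>X'. closedin (mtopology_of X) X' \<and> geodesically_convex X X' \<and>
              (\<forall>g\<in>carrier G. \<phi> g ` X' = X') \<and> quasi_dense X X' \<and>
              (\<exists>(X\<^sub>1 :: 'x metric) (X\<^sub>2 :: 'x metric) f.
                 isometry_between (submetric X X') (prod_metric X\<^sub>1 X\<^sub>2) f \<and>
                 product_action_via G H K \<phi> X' X\<^sub>1 X\<^sub>2 f)"
proof -
  note HK = internal_direct_productD[OF is_group prod]
  note HG = subgroup.mem_carrier[OF HK(1)] and KG = subgroup.mem_carrier[OF HK(2)]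
  interpret H: hadamard_isometries M d "\<phi> ` H"
    using subgroup_isometries[OF HK(1)] .
  obtain C where C: "H.minimal C"
    using ex_minimal_factor[OF HK(1) T(1,2) _ _ S] HK(3,4) unfolding K_def by metis
  obtain c where c: "c \<in> C"
    using H.minimal_nonempty[OF C] by blast
  define Z where "Z = H.minimal_union"
  note ZM = subsetD[OF H.minimal_union_subset, folded Z_def]
  have CZ: "C \<subseteq> Z"
    using H.minimal_subset_union[OF C] by (simp add: Z_def)
  have centr: "H.centralising (\<phi> k)" if "k \<in> K" for k
    unfolding H.centralising_def
  proof (intro conjI ballI)
    fix \<gamma> x assume "\<gamma> \<in> \<phi> ` H" and x: "x \<in> M"
    then obtain h where h: "h \<in> H" "\<gamma> = \<phi> h"
      by blast
    show "\<phi> k (\<gamma> x) = \<gamma> (\<phi> k x)"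
      using act_commute[OF KG[OF that] HG[OF h(1)] x] HK(4)[OF h(1) that] h(2) by simp
  qed (use act_in[OF KG[OF that]] act_isometric[OF KG[OF that]] in blast)+
  have H_Z: "\<phi> h x \<in> Z" "H.cell (\<phi> h x) = H.cell x" if "h \<in> H" "x \<in> Z" for h x
    using H.invariant_cell[of "\<phi> h" x] that unfolding Z_def by auto
  have K_Z: "\<phi> k x \<in> Z" if "k \<in> K" "x \<in> Z" for k x
    using H.centralising_cell(2)[OF centr] that unfolding Z_def by blast
  have G_Z: "\<phi> g x \<in> Z" if "g \<in> carrier G" "x \<in> Z" for g x
    using HK(3)[OF that(1)] act_mult[OF HG KG ZM[OF that(2)]] H_Z(1) K_Z that(2) by metis
  have G_image: "\<phi> g ` Z = Z" if g: "g \<in> carrier G" for g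
  proof
    show "\<phi> g ` Z \<subseteq> Z"
      using G_Z[OF g] by blast
    show "Z \<subseteq> \<phi> g ` Z"
    proof
      fix x assume "x \<in> Z"
      then show "x \<in> \<phi> g ` Z"
        using act_inv(2)[OF g ZM] G_Z[OF inv_closed[OF g]] by (metis imageI)
    qed
  qed
  have proj_K: "proj C (\<phi> k x) = proj C x" if "k \<in> K" "x \<in> Z" for k x
  proof -
    have involution: "proj C (\<phi> s x) = proj C x" if "s \<in> T" "x \<in> Z" for s x
    proof -
      have s: "s \<in> K" "s \<in> carrier G"
        using that(1) T(1) unfolding K_def by (auto intro: generate.incl)
      show ?thesis
      proof (rule H.proj_centralising_involution[OF centr[OF s(1)] _ C])
        show "\<phi> s (\<phi> s y) = y" if "y \<in> M" for y
          using act_mult[OF s(2) s(2) that] T(3) \<open>s \<in> T\<close> act_one[OF that] by simp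
      qed (use that in \<open>simp add: Z_def\<close>)
    qed
    show ?thesis
      using \<open>k \<in> K\<close> \<open>x \<in> Z\<close> unfolding K_def
    proof (induction arbitrary: x rule: generate.induct)
      case one
      then show ?case
        using act_one ZM by simp
    next
      case (incl s)
      then show ?case
        using involution by blast
    next
      case (inv s)
      then show ?case
        using involution inv_involution T by (metis subsetD)
    next
      case (eng k l)
      then have "k \<in> K" "l \<in> K"
        by (auto simp: K_def)
      then show ?case
        using eng act_mult[OF KG KG ZM] K_Z by simp
    qed
  qed
  define f where "f p = (proj C p, proj (H.cell p) c)" for p
  define X\<^sub>1 where "X\<^sub>1 = submetric X C"
  define X\<^sub>2 where "X\<^sub>2 = submetric X (H.fibre C c)"
  \<comment> \<open>The action on the second factor: \<phi> \<open>k\<close> permutes the cells, and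
    sliding back within the new cell to the point over \<open>c\<close> returns to the
    fibre.\<close>
  define \<psi> where "\<psi> k t = proj (H.cell (\<phi> k t)) c" for k t
  have space: "mspace X\<^sub>1 = C" "mdist X\<^sub>1 = d" "mspace X\<^sub>2 = H.fibre C c" "mdist X\<^sub>2 = d"
    using H.minimal_subset[OF C] H.minimal_union_subset
    by (auto simp: X\<^sub>1_def X\<^sub>2_def H.fibre_def)
  have fib: "t \<in> Z" "proj (H.cell t) c = t" if "t \<in> H.fibre C c" for t
    using that H.proj_cell_proj[OF C, of t] by (auto simp: H.fibre_def Z_def)
  have fib_in: "proj (H.cell x) c \<in> H.fibre C c" if "x \<in> Z" for x
    using H.proj_cell[OF C c] that by (simp add: H.fibre_def Z_def)
  have \<psi>_f: "\<psi> k (proj (H.cell x) c) = proj (H.cell (\<phi> k x)) c" if "k \<in> K" "x \<in> Z" for k x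
    using H.proj_cell_centralising[OF centr[OF that(1)] C c] that(2) by (simp add: \<psi>_def Z_def)
  have isom: "isometry_between (submetric X Z) (prod_metric X\<^sub>1 X\<^sub>2) f"
    unfolding isometry_between_def
  proof (intro conjI ballI)
    have "bij_betw f Z (C \<times> H.fibre C c)"
      unfolding f_def Z_def using H.bij_betw_minimal_union[OF C c] .
    moreover have "mspace (submetric X Z) = Z"
      using ZM by auto
    ultimately show "bij_betw f (mspace (submetric X Z)) (mspace (prod_metric X\<^sub>1 X\<^sub>2))"
      by (simp add: space)
    fix p q assume "p \<in> mspace (submetric X Z)" "q \<in> mspace (submetric X Z)"
    then have "p \<in> H.minimal_union" "q \<in> H.minimal_union"
      by (auto simp: Z_def)
    then show "mdist (prod_metric X\<^sub>1 X\<^sub>2) (f p) (f q) = mdist (submetric X Z) p q"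
      using H.minimal_union_dist[OF C c, of p q, symmetric]
      by (simp add: f_def prod_dist_def space)
  qed
  have act1: "isometric_action (G\<lparr>carrier := H\<rparr>) X\<^sub>1 (\<lambda>h. \<lambda>x\<in>mspace X\<^sub>1. \<phi> h x)"
  proof (rule isometric_actionI[OF subgroup_imp_group[OF HK(1)]])
    note CM = subsetD[OF H.minimal_subset[OF C]]
    show "\<phi> g x \<in> mspace X\<^sub>1" if "g \<in> carrier (G\<lparr>carrier := H\<rparr>)" "x \<in> mspace X\<^sub>1" for g x
      using H.minimal_invariant[OF C, of "\<phi> g"] that by (simp add: space)
    show "mdist X\<^sub>1 (\<phi> g x) (\<phi> g y) = mdist X\<^sub>1 x y"
      if "g \<in> carrier (G\<lparr>carrier := H\<rparr>)" "x \<in> mspace X\<^sub>1" "y \<in> mspace X\<^sub>1" for g x y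
      using act_isometric[OF HG CM CM] that by (simp add: space)
  qed (use act_mult[OF HG HG] act_one H.minimal_subset[OF C] in \<open>auto simp: space\<close>)
  have act2: "isometric_action (G\<lparr>carrier := K\<rparr>) X\<^sub>2 (\<lambda>k. \<lambda>x\<in>mspace X\<^sub>2. \<psi> k x)"
  proof (rule isometric_actionI[OF subgroup_imp_group[OF HK(2)]])
    show "\<psi> k t \<in> mspace X\<^sub>2" if "k \<in> carrier (G\<lparr>carrier := K\<rparr>)" "t \<in> mspace X\<^sub>2" for k t
      using that fib_in K_Z fib(1) by (simp add: space \<psi>_def)
    show "\<psi> (k \<otimes>\<^bsub>G\<lparr>carrier := K\<rparr>\<^esub> l) t = \<psi> k (\<psi> l t)"
      if "k \<in> carrier (G\<lparr>carrier := K\<rparr>)" "l \<in> carrier (G\<lparr>carrier := K\<rparr>)" "t \<in> mspace X\<^sub>2" for k l t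
    proof -
      have kl: "k \<in> K" "l \<in> K" and t: "t \<in> Z"
        using that fib(1) by (simp_all add: space)
      have "\<psi> k (\<psi> l t) = proj (H.cell (\<phi> k (\<phi> l t))) c"
        using \<psi>_f[OF kl(1) K_Z[OF kl(2) t]] by (simp add: \<psi>_def[of l])
      then show ?thesis
        using act_mult[OF KG KG ZM] kl t by (simp add: \<psi>_def)
    qed
    show "\<psi> \<one>\<^bsub>G\<lparr>carrier := K\<rparr>\<^esub> t = t" if "t \<in> mspace X\<^sub>2" for t
      using that fib act_one ZM by (simp add: space \<psi>_def)
    show "mdist X\<^sub>2 (\<psi> k t) (\<psi> k u) = mdist X\<^sub>2 t u"
      if "k \<in> carrier (G\<lparr>carrier := K\<rparr>)" "t \<in> mspace X\<^sub>2" "u \<in> mspace X\<^sub>2" for k t u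
      using H.dist_proj_cell_centralising[OF centr C c, of k t u] that fib
      by (simp add: space \<psi>_def Z_def)
  qed
  \<comment> \<open>\<open>h\<close> preserves every cell and so leaves the second coordinate alone;
    \<open>k\<close> leaves the first alone by \<open>proj_K\<close>.\<close>
  have equiv: "f (\<phi> (h \<otimes> k) x) =
      ((\<lambda>x\<in>mspace X\<^sub>1. \<phi> h x) (fst (f x)), (\<lambda>x\<in>mspace X\<^sub>2. \<psi> k x) (snd (f x)))"
    if "h \<in> H" "k \<in> K" "x \<in> Z" for h k x
  proof -
    have kx: "\<phi> k x \<in> Z" "x \<in> M" "\<phi> k x \<in> M"
      using K_Z that ZM by auto
    have "proj C (\<phi> h (\<phi> k x)) = \<phi> h (proj C x)"
      using H.minimal_proj_equivariant[OF C, of "\<phi> h" "\<phi> k x"] that kx proj_K by simp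
    moreover have "proj (H.cell (\<phi> h (\<phi> k x))) c = \<psi> k (proj (H.cell x) c)"
      using H_Z(2)[OF that(1) kx(1)] \<psi>_f that by simp
    ultimately show ?thesis
      using act_mult[OF HG KG kx(2)] that fib_in H.minimal_proj_in(1)[OF C kx(2)]
      by (simp add: f_def space)
  qed
  show ?thesis
  proof (intro exI[of _ Z] conjI ballI)
    have Zc: "closed_convex Z"
      unfolding Z_def by (rule H.closed_convex_minimal_union)
    then show "closedin (mtopology_of X) Z"
      by (simp add: closed_convex_def mtopology_of_def)
    show "geodesically_convex X Z"
      using Zc by (rule geodesically_convex_closed_convex)
    show "quasi_dense X Z"
      using ZM c CZ G_Z by (intro quasi_dense_invariant[of Z c]) auto
    show "\<exists>(X\<^sub>1 :: 'x metric) (X\<^sub>2 :: 'x metric) f.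
        isometry_between (submetric X Z) (prod_metric X\<^sub>1 X\<^sub>2) f \<and> product_action_via G H K \<phi> Z X\<^sub>1 X\<^sub>2 f"
      using isom act1 act2 equiv unfolding product_action_via_def by blast
  qed (rule G_image)
qed

end

theorem corollary1p4:
  fixes W :: "('a, 'b) monoid_scheme"
    and S S\<^sub>1 S\<^sub>2 :: "'a set"
    and X :: "'x metric"
    and \<phi> :: "'a \<Rightarrow> 'x \<Rightarrow> 'x"
  assumes "coxeter_system W S"
    and "S\<^sub>1 \<subseteq> S" and "S\<^sub>2 \<subseteq> S"
    and "internal_direct_product W (parabolic W S\<^sub>1) (parabolic W S\<^sub>2)"
    and "CAT0 X"
    and "geometric_action W X \<phi>"
  shows "\<exists>X'. closedin (mtopology_of X) X' \<and> geodesically_convex X X' \<and>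
              (\<forall>w \<in> carrier W. \<phi> w ` X' = X') \<and> quasi_dense X X' \<and>
              (\<exists>(X\<^sub>1 :: 'x metric) (X\<^sub>2 :: 'x metric) f.
                 isometry_between (submetric X X') (prod_metric X\<^sub>1 X\<^sub>2) f \<and>
                 product_action_via W (parabolic W S\<^sub>1) (parabolic W S\<^sub>2) \<phi> X' X\<^sub>1 X\<^sub>2 f)"
proof -
  note W = coxeter_system_involutions[OF assms(1)]
  interpret geometric_CAT0_action W X \<phi>
    using assms(5,6) by unfold_locales
  show ?thesis
    unfolding parabolic_def
    using assms(2-4) W(2-5) finite_subset[OF assms(3)]
    by (intro splitting[of _ S\<^sub>2 S]) (auto simp: parabolic_def)
qed

end
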